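(* Let $(X,\varphi)$ be a Stone system. The distance $d$ on the group $\mathsf{H}_0(\varphi)$ defined by $d(g,h)=d_+(g,h)+d_+(g^{-1},h^{-1})$, where $$d_+(g,h)=\inf_{\tau,\lambda}\ \sup_{y\in Y^\varphi}|\tau(y)-\lambda(y)|,$$ the infimum being over all displacement functions $\tau$ of $g$ and $\lambda$ of $h$, is complete and defines a group topology on $\mathsf{H}_0(\varphi)$.
   Context: A Stone system $(X,\varphi)$ is a non-empty totally disconnected compact Hausdorff space $X$ together with a self-homeomorphism $\varphi$ of $X$. Suspension: $Y^\varphi=(X\times\mathbb R)/\mathbb Z$, the quotient by the $\mathbb Z$-action $n\cdot(x,t)=(\varphi^n(x),t-n)$; $[x,t]$ is the class of $(x,t)$, and the suspension flow is $\Phi^t([x,s])=[x,s+t]$. $\mathsf{H}_0(\varphi)$ is the group of homeomorphisms of $Y^\varphi$ that are isotopic to the identity; equivalently (Boyle–Carlsen–Eilers), the homeomorphisms $g$ of $Y^\varphi$ for which there is a continuous $\tau\colon Y^\varphi\to\mathbb R$ with $g(y)=\Phi^{\tau(y)}(y)$ for all $y$. Any such continuous $\tau$ is called a displacement function for $g$ (it need not be unique). *)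

theory Defs
  imports "HOL-Analysis.Analysis" "HOL-Algebra.Bij"
begin

section \<open>Stone systems\<close>

definition totally_disconnected_space :: "'a topology \<Rightarrow> bool" where
  "totally_disconnected_space X \<longleftrightarrow>
     (\<forall>x \<in> topspace X. connected_component_of_set X x = {x})"

locale stone_system =
  fixes X :: "'a topology" and \<phi> :: "'a \<Rightarrow> 'a"
  assumes nonempty: "topspace X \<noteq> {}"
    and compact: "compact_space X"
    and Hausdorff: "Hausdorff_space X"
    and totally_disconnected: "totally_disconnected_space X"
    and homeo: "homeomorphic_map X X \<phi>"

section \<open>Quotient topology\<close>

definition quotient_topology :: "'a topology \<Rightarrow> ('a \<Rightarrow> 'b) \<Rightarrow> 'b topology" where
  "quotient_topology X q =
     topology (\<lambda>U. U \<subseteq> q ` topspace X \<and> openin X {x \<in> topspace X. q x \<in> U})"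

lemma openin_quotient_topology:
  "openin (quotient_topology X q) U \<longleftrightarrow>
     U \<subseteq> q ` topspace X \<and> openin X {x \<in> topspace X. q x \<in> U}"
proof -
  have "istopology (\<lambda>U. U \<subseteq> q ` topspace X \<and> openin X {x \<in> topspace X. q x \<in> U})"
    unfolding istopology_def
  proof (intro conjI allI impI)
    fix S T
    assume "S \<subseteq> q ` topspace X \<and> openin X {x \<in> topspace X. q x \<in> S}"
      and "T \<subseteq> q ` topspace X \<and> openin X {x \<in> topspace X. q x \<in> T}"
    moreover have "{x \<in> topspace X. q x \<in> S \<inter> T} =
        {x \<in> topspace X. q x \<in> S} \<inter> {x \<in> topspace X. q x \<in> T}"
      by auto
    ultimately show "S \<inter> T \<subseteq> q ` topspace X" "openin X {x \<in> topspace X. q x \<in> S \<inter> T}"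
      by auto
  next
    fix \<K>
    assume *: "\<forall>K\<in>\<K>. K \<subseteq> q ` topspace X \<and> openin X {x \<in> topspace X. q x \<in> K}"
    then show "\<Union>\<K> \<subseteq> q ` topspace X" by auto
    have "{x \<in> topspace X. q x \<in> \<Union>\<K>} = (\<Union>K\<in>\<K>. {x \<in> topspace X. q x \<in> K})"
      by auto
    with * show "openin X {x \<in> topspace X. q x \<in> \<Union>\<K>}" by auto
  qed
  then show ?thesis
    by (simp add: quotient_topology_def topology_inverse')
qed

lemma topspace_quotient_topology [simp]:
  "topspace (quotient_topology X q) = q ` topspace X"
proof -
  have "{x \<in> topspace X. q x \<in> q ` topspace X} = topspace X"
    by auto
  then have "openin (quotient_topology X q) (q ` topspace X)"
    by (simp add: openin_quotient_topology)
  then show ?thesis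
    by (metis openin_quotient_topology openin_subset openin_topspace subset_antisym)
qed

lemma quotient_map_quotient_topology: "quotient_map X (quotient_topology X q) q"
  by (auto simp: quotient_map_def openin_quotient_topology)

section \<open>The suspension and its flow\<close>

definition zpow :: "'a topology \<Rightarrow> ('a \<Rightarrow> 'a) \<Rightarrow> int \<Rightarrow> 'a \<Rightarrow> 'a" where
  "zpow X \<phi> n x =
     (if 0 \<le> n then (\<phi> ^^ nat n) x else (inv_into (topspace X) \<phi> ^^ nat (- n)) x)"

definition zact :: "'a topology \<Rightarrow> ('a \<Rightarrow> 'a) \<Rightarrow> int \<Rightarrow> 'a \<times> real \<Rightarrow> 'a \<times> real" where
  "zact X \<phi> n = (\<lambda>(x, t). (zpow X \<phi> n x, t - of_int n))"

text \<open>The class \<open>[x,t]\<close>, represented by the orbit of \<open>(x,t)\<close>.\<close>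

definition sus_class :: "'a topology \<Rightarrow> ('a \<Rightarrow> 'a) \<Rightarrow> 'a \<times> real \<Rightarrow> ('a \<times> real) set" where
  "sus_class X \<phi> p = range (\<lambda>n. zact X \<phi> n p)"

definition suspension :: "'a topology \<Rightarrow> ('a \<Rightarrow> 'a) \<Rightarrow> ('a \<times> real) set topology" where
  "suspension X \<phi> = quotient_topology (prod_topology X euclideanreal) (sus_class X \<phi>)"

text \<open>Translation in the real coordinate commutes with the action, so the image of an orbit
  under it is again an orbit; see \<open>sus_flow_class\<close>.\<close>

definition sus_flow :: "real \<Rightarrow> ('a \<times> real) set \<Rightarrow> ('a \<times> real) set" where
  "sus_flow t C = (\<lambda>(x, s). (x, s + t)) ` C"

lemma sus_flow_class: "sus_flow t (sus_class X \<phi> (x, s)) = sus_class X \<phi> (x, s + t)"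
  by (simp add: sus_flow_def sus_class_def zact_def image_image algebra_simps)

context stone_system
begin

lemma bij_phi: "bij_betw \<phi> (topspace X) (topspace X)"
  using homeo
  by (metis bij_betw_def homeomorphic_imp_injective_map homeomorphic_imp_surjective_map)

lemma zpow_in: "x \<in> topspace X \<Longrightarrow> zpow X \<phi> n x \<in> topspace X"
proof -
  assume x: "x \<in> topspace X"
  have "(\<phi> ^^ k) x \<in> topspace X" for k
    by (induction k) (use x bij_phi in \<open>auto simp: bij_betw_def\<close>)
  moreover have "(inv_into (topspace X) \<phi> ^^ k) x \<in> topspace X" for k
    by (induction k) (use x bij_phi bij_betw_inv_into in \<open>auto simp: bij_betw_def inv_into_into\<close>)
  ultimately show ?thesis
    by (simp add: zpow_def)
qed

lemma zpow_0: "zpow X \<phi> 0 x = x"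
  by (simp add: zpow_def)

lemma zpow_plus1:
  assumes x: "x \<in> topspace X"
  shows "zpow X \<phi> (n + 1) x = \<phi> (zpow X \<phi> n x)"
proof (cases "0 \<le> n")
  case True
  then show ?thesis
    by (simp add: zpow_def nat_add_distrib)
next
  case False
  define k where "k = nat (- n - 1)"
  have n: "n = - int (Suc k)"
    using False by (simp add: k_def)
  have "zpow X \<phi> n x = inv_into (topspace X) \<phi> (zpow X \<phi> (n + 1) x)"
    by (auto simp: zpow_def n nat_add_distrib)
  then show ?thesis
    using bij_betw_inv_into_right[OF bij_phi zpow_in[OF x]] by metis
qed

lemma zpow_add:
  assumes x: "x \<in> topspace X"
  shows "zpow X \<phi> (m + n) x = zpow X \<phi> m (zpow X \<phi> n x)"
proof (induction m rule: int_induct[where k = 0])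
  case base
  then show ?case by (simp add: zpow_0)
next
  case (step1 m)
  then show ?case
    using zpow_plus1[OF x, of "m + n"] zpow_plus1[OF zpow_in[OF x], of m n]
    by (simp add: algebra_simps)
next
  case (step2 m)
  have "\<phi> (zpow X \<phi> (m - 1 + n) x) = \<phi> (zpow X \<phi> (m - 1) (zpow X \<phi> n x))"
    using zpow_plus1[OF x, of "m - 1 + n"] zpow_plus1[OF zpow_in[OF x], of "m - 1" n] step2
    by (simp add: algebra_simps)
  then show ?case
    using bij_phi zpow_in[OF x] zpow_in[OF zpow_in[OF x]]
    by (meson bij_betw_imp_inj_on inj_onD)
qed

lemma sus_class_eq_iff:
  assumes x: "x \<in> topspace X" and y: "y \<in> topspace X"
  shows "sus_class X \<phi> (x, s) = sus_class X \<phi> (y, t) \<longleftrightarrow>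
           (\<exists>n. (y, t) = zact X \<phi> n (x, s))"
proof
  assume "sus_class X \<phi> (x, s) = sus_class X \<phi> (y, t)"
  moreover have "(y, t) \<in> sus_class X \<phi> (y, t)"
    unfolding sus_class_def by (rule range_eqI[of _ _ 0]) (simp add: zact_def zpow_0)
  ultimately show "\<exists>n. (y, t) = zact X \<phi> n (x, s)"
    by (auto simp: sus_class_def)
next
  assume "\<exists>n. (y, t) = zact X \<phi> n (x, s)"
  then obtain n where n: "(y, t) = zact X \<phi> n (x, s)" by blast
  have "zact X \<phi> m (y, t) = zact X \<phi> (m + n) (x, s)" for m
    using n by (simp add: zact_def zpow_add[OF x])
  moreover from this have "zact X \<phi> m (x, s) = zact X \<phi> (m - n) (y, t)" for m
    by simp
  ultimately show "sus_class X \<phi> (x, s) = sus_class X \<phi> (y, t)"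
    unfolding sus_class_def by (metis (no_types, lifting) rangeE rangeI subsetI subset_antisym)
qed

end

section \<open>The group \<open>H\<^sub>0(\<phi>)\<close>\<close>

text \<open>Homeomorphisms of the suspension are made unique as functions by requiring them to be
  extensional, as in \<^const>\<open>BijGroup\<close>. An isotopy is a homotopy through homeomorphisms.\<close>

definition H0 :: "'a topology \<Rightarrow> ('a \<Rightarrow> 'a) \<Rightarrow> (('a \<times> real) set \<Rightarrow> ('a \<times> real) set) monoid" where
  "H0 X \<phi> = (let Y = suspension X \<phi> in
     BijGroup (topspace Y)
       \<lparr>carrier := {g \<in> Bij (topspace Y).
          homotopic_with (homeomorphic_map Y Y) Y Y g (\<lambda>y. y)}\<rparr>)"

definition displacement_fun ::
    "'a topology \<Rightarrow> ('a \<Rightarrow> 'a) \<Rightarrow> (('a \<times> real) set \<Rightarrow> ('a \<times> real) set) \<Rightarrow>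
      (('a \<times> real) set \<Rightarrow> real) \<Rightarrow> bool" where
  "displacement_fun X \<phi> g \<tau> \<longleftrightarrow>
     continuous_map (suspension X \<phi>) euclideanreal \<tau> \<and>
     (\<forall>y \<in> topspace (suspension X \<phi>). g y = sus_flow (\<tau> y) y)"

text \<open>For a Stone system the suspension is compact and non-empty, so the real-valued supremum
  below is a supremum of a non-empty bounded set whenever \<open>\<tau>\<close> and \<open>\<mu>\<close> are displacement functions.
  Every element of \<open>H\<^sub>0(\<phi>)\<close> has a displacement function (Boyle-Carlsen-Eilers), so the infimum is
  likewise over a non-empty set.\<close>

definition dplus ::
    "'a topology \<Rightarrow> ('a \<Rightarrow> 'a) \<Rightarrow> (('a \<times> real) set \<Rightarrow> ('a \<times> real) set) \<Rightarrow>
      (('a \<times> real) set \<Rightarrow> ('a \<times> real) set) \<Rightarrow> real" where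
  "dplus X \<phi> g h =
     (INF (\<tau>, \<mu>) \<in> {\<tau>. displacement_fun X \<phi> g \<tau>} \<times> {\<mu>. displacement_fun X \<phi> h \<mu>}.
        SUP y \<in> topspace (suspension X \<phi>). \<bar>\<tau> y - \<mu> y\<bar>)"

text \<open>\<^const>\<open>Metric_space\<close> demands non-negativity and symmetry on the whole type, hence the
  value \<open>0\<close> outside the group.\<close>

definition H0_dist ::
    "'a topology \<Rightarrow> ('a \<Rightarrow> 'a) \<Rightarrow> (('a \<times> real) set \<Rightarrow> ('a \<times> real) set) \<Rightarrow>
      (('a \<times> real) set \<Rightarrow> ('a \<times> real) set) \<Rightarrow> real" where
  "H0_dist X \<phi> g h =
     (if g \<in> carrier (H0 X \<phi>) \<and> h \<in> carrier (H0 X \<phi>)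
      then dplus X \<phi> g h + dplus X \<phi> (inv\<^bsub>H0 X \<phi>\<^esub> g) (inv\<^bsub>H0 X \<phi>\<^esub> h)
      else 0)"

definition group_topology :: "('g, 'm) monoid_scheme \<Rightarrow> 'g topology \<Rightarrow> bool" where
  "group_topology G T \<longleftrightarrow>
     group G \<and> topspace T = carrier G \<and>
     continuous_map (prod_topology T T) T (\<lambda>(x, y). x \<otimes>\<^bsub>G\<^esub> y) \<and>
     continuous_map T T (\<lambda>x. inv\<^bsub>G\<^esub> x)"

end

(* If [x,t] = [x,t+c] then c is an integer, so two displacement functions of the same map that are
   less than 1 apart coincide.  Moreover the difference of two displacement functions of one map can
   be added to a displacement function of any other map.  Hence, near a map g with displacement
   function tau, every h has a well-defined nearest displacement function, a Cauchy sequence in d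
   yields uniformly convergent displacement functions of the maps and of their inverses, and the
   two limits displace mutually inverse maps.

   A bijection g with displacement function tau is isotopic to the identity through
   y |-> Phi^(c tau(y))(y): along each orbit s |-> s + tau(Phi^s(y)) is injective, hence increasing,
   and so are its convex combinations with the identity.  Conversely, in an isotopy h the point
   h(t,y) moves, for t in a short interval that is uniform in y, inside a flow box
   X x interval; as X is totally disconnected it moves along the flow, by an amount read off from
   the map [x,t] |-> exp(2 pi i t) to the circle. *)

theory Submission
  imports Defs
begin

text \<open>The set where \<open>f\<close> is \<open>e\<close>-close to its values over
  \<open>t0\<close> is open and contains the slice over \<open>t0\<close>; compactness of
  \<open>Y\<close> yields a whole tube inside it. The parameter \<open>t\<close> will be a flow time
  or the time of an isotopy.\<close>

lemma tube_uniform: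
  fixes f :: "'b \<times> 'c \<Rightarrow> 'd::real_normed_vector"
  assumes Y: "compact_space Y" and f: "continuous_map (prod_topology T Y) euclidean f"
    and t0: "t0 \<in> topspace T" and e: "e > 0"
  obtains U where "openin T U" "t0 \<in> U"
    "\<And>t y. t \<in> U \<Longrightarrow> y \<in> topspace Y \<Longrightarrow> norm (f (t, y) - f (t0, y)) < e"
proof -
  let ?n = "\<lambda>p. norm (f p - f (t0, snd p))"
  define W where "W = {p \<in> topspace (prod_topology T Y). ?n p \<in> {..<e}}"
  have "continuous_map (prod_topology T Y) (prod_topology T Y) (\<lambda>p. (t0, snd p))"
    using t0 by (intro continuous_map_pairedI continuous_map_snd) auto
  then have "continuous_map (prod_topology T Y) euclidean (\<lambda>p. f (t0, snd p))"
    using continuous_map_compose[OF _ f] by (simp add: o_def)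
  then have "continuous_map (prod_topology T Y) euclideanreal ?n"
    by (intro continuous_map_norm continuous_map_diff f)
  then have "openin (prod_topology T Y) W"
    unfolding W_def by (rule openin_continuous_map_preimage) simp
  moreover have "{t0} \<times> topspace Y \<subseteq> W"
    using t0 e by (auto simp: W_def)
  ultimately obtain U V where "openin T U" "t0 \<in> U" "topspace Y \<subseteq> V" "U \<times> V \<subseteq> W"
    using tube_lemma_right[of T Y W "topspace Y" t0] Y t0 by (auto simp: compact_space_def)
  moreover from this have "norm (f (t, y) - f (t0, y)) < e" if "t \<in> U" "y \<in> topspace Y" for t y
    using that by (force simp: W_def)
  ultimately show thesis
    by (intro that)
qed

section \<open>Compact flows with integral periods\<close>

text \<open>The metric arguments use the suspension only through these properties. By
  \<open>period_Ints\<close>, two displacement functions of one map differ by an integer at each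
  point.\<close>

locale integral_flow =
  fixes Y :: "'b topology" and F :: "real \<Rightarrow> 'b \<Rightarrow> 'b"
  assumes compact_Y: "compact_space Y"
    and Hausdorff_Y: "Hausdorff_space Y"
    and nonempty_Y: "topspace Y \<noteq> {}"
    and flow_cont: "continuous_map (prod_topology euclideanreal Y) Y (\<lambda>(t, y). F t y)"
    and flow_0: "y \<in> topspace Y \<Longrightarrow> F 0 y = y"
    and flow_add: "y \<in> topspace Y \<Longrightarrow> F (s + t) y = F s (F t y)"
    and period_Ints: "y \<in> topspace Y \<Longrightarrow> F c y = y \<Longrightarrow> c \<in> \<int>"
begin

lemma flow_in: "y \<in> topspace Y \<Longrightarrow> F t y \<in> topspace Y"
  using continuous_map_funspace[OF flow_cont] by (simp add: Pi_iff)

lemma continuous_map_flow: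
  assumes "continuous_map Z euclideanreal \<tau>" "continuous_map Z Y g"
  shows "continuous_map Z Y (\<lambda>z. F (\<tau> z) (g z))"
  using continuous_map_compose[OF continuous_map_pairedI[OF assms] flow_cont]
  by (simp add: o_def)

lemma flow_minus: "y \<in> topspace Y \<Longrightarrow> F (- t) (F t y) = y"
  using flow_add[of y "- t" t] flow_0 by simp

lemma flow_eq_imp_period:
  assumes "y \<in> topspace Y" "F s y = F t y"
  shows "F (s - t) y = y"
  using assms flow_add[of y "- t" s] flow_minus[of y t] by simp

lemma orbit_continuous_on:
  assumes \<tau>: "continuous_map Y euclideanreal \<tau>" and y: "y \<in> topspace Y"
  shows "continuous_on UNIV (\<lambda>s. \<tau> (F s y))"
proof -
  have "continuous_map euclideanreal Y (\<lambda>s. F s y)"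
    using y by (intro continuous_map_flow) auto
  from continuous_map_compose[OF this \<tau>] show ?thesis
    by (simp add: o_def)
qed

definition displ :: "('b \<Rightarrow> 'b) \<Rightarrow> ('b \<Rightarrow> real) \<Rightarrow> bool" where
  "displ g \<tau> \<longleftrightarrow> continuous_map Y euclideanreal \<tau> \<and> (\<forall>y \<in> topspace Y. g y = F (\<tau> y) y)"

lemma displ_cont: "displ g \<tau> \<Longrightarrow> continuous_map Y euclideanreal \<tau>"
  and displ_eq: "displ g \<tau> \<Longrightarrow> y \<in> topspace Y \<Longrightarrow> g y = F (\<tau> y) y"
  by (auto simp: displ_def)

lemma displ_in: "displ g \<tau> \<Longrightarrow> y \<in> topspace Y \<Longrightarrow> g y \<in> topspace Y"
  by (simp add: displ_eq flow_in)

lemma displ_continuous_map: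
  assumes "displ g \<tau>"
  shows "continuous_map Y Y g"
  by (rule continuous_map_eq[OF continuous_map_flow[OF displ_cont[OF assms] continuous_map_id]])
    (simp add: displ_eq[OF assms])

section \<open>Isotopies along the flow\<close>

lemma continuous_map_bounded:
  assumes "continuous_map Y euclideanreal \<tau>"
  obtains B where "\<And>y. y \<in> topspace Y \<Longrightarrow> \<bar>\<tau> y\<bar> \<le> B"
proof -
  have "compactin euclideanreal (\<tau> ` topspace Y)"
    using compact_Y assms image_compactin unfolding compact_space_def by blast
  then have "bounded (\<tau> ` topspace Y)"
    by (simp add: compact_imp_bounded)
  then show thesis
    using that unfolding bounded_iff by auto
qed

text \<open>In the time parameter of the orbit of \<open>y\<close>, \<open>g\<close> becomes
  \<open>s \<mapsto> s + \<tau> (F s y)\<close>. Injectivity of \<open>g\<close> makes this function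
  increasing, hence also its convex combinations with the identity. Monotonicity then gives
  injectivity, boundedness of \<open>\<tau>\<close> gives surjectivity, and compactness gives a
  continuous inverse.\<close>

lemma displ_scale_homeomorphic:
  assumes inj: "inj_on g (topspace Y)" and g: "displ g \<tau>" and c: "0 \<le> c" "c \<le> 1"
  shows "homeomorphic_map Y Y (\<lambda>y. F (c * \<tau> y) y)"
proof -
  obtain B where B: "\<And>y. y \<in> topspace Y \<Longrightarrow> \<bar>\<tau> y\<bar> \<le> B"
    using continuous_map_bounded[OF displ_cont[OF g]] by blast
  have cont: "continuous_on A (\<lambda>s. s + a * \<tau> (F s y))" if "y \<in> topspace Y" for y a A
    by (intro continuous_intros continuous_on_subset[OF orbit_continuous_on[OF displ_cont[OF g] that]])
      auto
  have bd: "\<bar>\<tau> (F s y)\<bar> \<le> B" if "y \<in> topspace Y" for s y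
    using B[OF flow_in[OF that]] .
  have inj1: "s = s'" if y: "y \<in> topspace Y" and eq: "s + \<tau> (F s y) = s' + \<tau> (F s' y)" for s s' y
  proof -
    have "g (F u y) = F (u + \<tau> (F u y)) y" for u
      using displ_eq[OF g flow_in[OF y]] flow_add[OF y, of "\<tau> (F u y)" u] by (simp add: add.commute)
    then have "g (F s y) = g (F s' y)"
      using eq by metis
    \<comment> \<open>On a periodic orbit this does not yet give \<open>s = s'\<close>, but
      \<open>\<tau>\<close> now has the same value at both times and cancels from
      \<open>eq\<close>.\<close>
    then have "F s y = F s' y"
      using inj flow_in[OF y] by (meson inj_onD)
    with eq show ?thesis by simp
  qed
  have mono1: "s + \<tau> (F s y) < s' + \<tau> (F s' y)" if y: "y \<in> topspace Y" and ss: "s < s'" for s s' y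
  proof (rule ccontr)
    let ?f = "\<lambda>s. s + 1 * \<tau> (F s y)"
    assume "\<not> ?thesis"
    then have 1: "?f s' \<le> ?f s" by simp
    \<comment> \<open>Since \<open>\<tau> \<ge> - B\<close> on the orbit, \<open>?f\<close> has
      climbed back to \<open>?f s\<close> at time \<open>u\<close>. So it takes the value
      \<open>?f s\<close> again at some time after \<open>s\<close>, against
      \<open>inj1\<close>.\<close>
    define u where "u = max s' (?f s + B)"
    have 2: "?f s \<le> ?f u"
      using bd[OF y, of u] by (simp add: u_def)
    obtain v where "s' \<le> v" "?f v = ?f s"
      using IVT'[OF 1 2 _ cont[OF y]] by (auto simp: u_def)
    with inj1[OF y, of v s] ss show False by simp
  qed
  have mono: "s + c * \<tau> (F s y) < s' + c * \<tau> (F s' y)" if y: "y \<in> topspace Y" and ss: "s < s'" for s s' y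
  proof (cases "c = 0")
    case False
    have "c * (s + \<tau> (F s y)) < c * (s' + \<tau> (F s' y))"
      using mono1[OF y ss] False c by simp
    moreover have "(1 - c) * s \<le> (1 - c) * s'"
      using c ss by (intro mult_left_mono) auto
    ultimately show ?thesis by (simp add: algebra_simps)
  qed (use ss in simp)
  show ?thesis
  proof (rule continuous_imp_homeomorphic_map[OF _ compact_Y Hausdorff_Y])
    show "continuous_map Y Y (\<lambda>y. F (c * \<tau> y) y)"
      using displ_cont[OF g] by (intro continuous_map_flow continuous_intros) auto
    \<comment> \<open>The displacement stays within \<open>B\<close>, so the sign changes between
      \<open>- B\<close> and \<open>B\<close>. The zero is the time at which the orbit of
      \<open>y\<close> meets a preimage of \<open>y\<close>.\<close>
    have "\<exists>s. s + c * \<tau> (F s y) = 0" if y: "y \<in> topspace Y" for y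
    proof -
      have "\<bar>c * \<tau> (F s y)\<bar> \<le> B" for s
        using bd[OF y, of s] c mult_mono[of c 1 "\<bar>\<tau> (F s y)\<bar>" B] by (simp add: abs_mult)
      note b = this[unfolded abs_le_iff]
      have B0: "B \<ge> 0" using bd[OF y, of 0] by simp
      show ?thesis
        using IVT'[of "\<lambda>s. s + c * \<tau> (F s y)" "- B" 0 B, OF _ _ _ cont[OF y]] b[of B] b[of "- B"] B0
        by fastforce
    qed
    note zero = this
    show "(\<lambda>y. F (c * \<tau> y) y) ` topspace Y = topspace Y"
    proof (intro subset_antisym subsetI)
      fix y assume y: "y \<in> topspace Y"
      then obtain s where "s + c * \<tau> (F s y) = 0" using zero by blast
      then have "y = F (c * \<tau> (F s y)) (F s y)"
        using flow_add[OF y, of "c * \<tau> (F s y)" s] flow_0[OF y] by (simp add: add.commute)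
      then show "y \<in> (\<lambda>y. F (c * \<tau> y) y) ` topspace Y"
        by (rule image_eqI[OF _ flow_in[OF y]])
    qed (auto simp: flow_in)
    show "inj_on (\<lambda>y. F (c * \<tau> y) y) (topspace Y)"
    proof (rule inj_onI)
      fix y y' assume y: "y \<in> topspace Y" "y' \<in> topspace Y" and eq: "F (c * \<tau> y) y = F (c * \<tau> y') y'"
      \<comment> \<open>\<open>r\<close> is the flow time from \<open>y\<close> to
        \<open>y'\<close>. Both \<open>r\<close> and \<open>0\<close> are sent to the same time on
        the orbit of \<open>y\<close>, which forces \<open>r = 0\<close>.\<close>
      define r where "r = c * \<tau> y - c * \<tau> y'"
      have y': "y' = F r y"
        using flow_minus[OF y(2), of "c * \<tau> y'"] eq flow_add[OF y(1), of "- (c * \<tau> y')" "c * \<tau> y"]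
        by (simp add: r_def)
      have "r + c * \<tau> (F r y) = 0 + c * \<tau> (F 0 y)"
        using flow_0[OF y(1)] y' by (simp add: r_def)
      then have "r = 0"
        using mono[OF y(1), of r 0] mono[OF y(1), of 0 r] by linarith
      then show "y = y'" using y' flow_0 y by simp
    qed
  qed
qed

lemma displ_imp_isotopic_id:
  assumes "inj_on g (topspace Y)" "displ g \<tau>"
  shows "homotopic_with (homeomorphic_map Y Y) Y Y g (\<lambda>y. y)"
proof (subst homotopic_with)
  show "homeomorphic_map Y Y h = homeomorphic_map Y Y k" if "\<And>x. x \<in> topspace Y \<Longrightarrow> h x = k x" for h k
    using that homeomorphic_map_eq by metis
  let ?T = "prod_topology (top_of_set {0..1::real}) Y"
  \<comment> \<open>The factor \<open>1 - t\<close> makes the homotopy start at \<open>g\<close> and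
    end at the identity.\<close>
  let ?h = "\<lambda>p. F ((1 - fst p) * \<tau> (snd p)) (snd p)"
  have "continuous_map ?T euclideanreal fst"
    using continuous_map_fst continuous_map_into_fulltopology by blast
  moreover have "continuous_map ?T euclideanreal (\<tau> \<circ> snd)"
    using displ_cont[OF assms(2)] continuous_map_compose continuous_map_snd by blast
  ultimately have h: "continuous_map ?T Y ?h"
    by (intro continuous_map_flow continuous_intros continuous_map_snd) (auto simp: o_def)
  show "\<exists>h. continuous_map ?T Y h \<and> (\<forall>x\<in>topspace Y. h (0, x) = g x) \<and>
     (\<forall>x\<in>topspace Y. h (1, x) = x) \<and> (\<forall>t\<in>{0..1}. homeomorphic_map Y Y (\<lambda>x. h (t, x)))"
  proof (rule exI[where x = ?h], intro conjI ballI)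
    show "homeomorphic_map Y Y (\<lambda>x. ?h (t, x))" if "t \<in> {0..1}" for t
      using displ_scale_homeomorphic[OF assms, of "1 - t"] that by simp
  qed (simp_all add: h displ_eq[OF assms(2)] flow_0)
qed

section \<open>Algebra of displacement functions\<close>

lemma displ_shift:
  assumes g: "displ g \<tau>" and a: "displ h a" and b: "displ h b"
  shows "displ g (\<lambda>y. \<tau> y + (a y - b y))"
  unfolding displ_def
proof (intro conjI ballI)
  show "continuous_map Y euclideanreal (\<lambda>y. \<tau> y + (a y - b y))"
    using assms by (intro continuous_intros displ_cont)
  fix y assume y: "y \<in> topspace Y"
  \<comment> \<open>Flowing \<open>y\<close> for time \<open>a y\<close> or \<open>b y\<close>
    reaches the same point \<open>h y\<close>, so the difference is a period of \<open>y\<close>,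
    and adding it to \<open>\<tau> y\<close> changes nothing.\<close>
  have "F (a y - b y) y = y"
    using flow_eq_imp_period[OF y] displ_eq[OF a y] displ_eq[OF b y] by simp
  then show "g y = F (\<tau> y + (a y - b y)) y"
    using flow_add[OF y] displ_eq[OF g y] by simp
qed

text \<open>The difference is a period, hence an integer, and an integer of absolute value below
  \<open>1\<close> vanishes. This makes nearby displacement functions unique.\<close>

lemma displ_unique:
  assumes "displ h a" "displ h b" "y \<in> topspace Y" "\<bar>a y - b y\<bar> < 1"
  shows "a y = b y"
proof -
  have "a y - b y \<in> \<int>"
    using assms period_Ints flow_eq_imp_period displ_eq by metis
  then show ?thesis
    using assms(4) Ints_nonzero_abs_less1 by fastforce
qed

lemma displ_compose:
  assumes g: "displ g \<tau>" and h: "displ h \<sigma>"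
  shows "displ (compose (topspace Y) g h) (\<lambda>y. \<tau> (h y) + \<sigma> y)"
  unfolding displ_def
proof (intro conjI ballI)
  show "continuous_map Y euclideanreal (\<lambda>y. \<tau> (h y) + \<sigma> y)"
    using continuous_map_compose[OF displ_continuous_map[OF h] displ_cont[OF g]]
    by (intro continuous_intros displ_cont[OF h]) (simp add: o_def)
  fix y assume y: "y \<in> topspace Y"
  show "compose (topspace Y) g h y = F (\<tau> (h y) + \<sigma> y) y"
    using y displ_eq[OF h y] displ_eq[OF g displ_in[OF h y]] by (simp add: flow_add compose_eq)
qed

abbreviation inverse_map :: "('b \<Rightarrow> 'b) \<Rightarrow> 'b \<Rightarrow> 'b" where
  "inverse_map g \<equiv> restrict (inv_into (topspace Y) g) (topspace Y)"

lemma displ_inverse: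
  assumes g: "g \<in> Bij (topspace Y)" "displ g \<tau>"
  shows "displ (inverse_map g) (\<lambda>y. - \<tau> (inv_into (topspace Y) g y))"
proof -
  have bij: "bij_betw g (topspace Y) (topspace Y)"
    using g by (simp add: Bij_def)
  \<comment> \<open>The scaling lemma at \<open>c = 1\<close> supplies the continuity of the
    inverse, which membership in \<open>Bij\<close> does not provide.\<close>
  have "homeomorphic_map Y Y g"
    using displ_scale_homeomorphic[OF bij_betw_imp_inj_on[OF bij] g(2), of 1]
      homeomorphic_map_eq[of Y Y _ g] displ_eq[OF g(2)] by simp
  then obtain k where k: "homeomorphic_maps Y Y g k"
    using homeomorphic_map_maps by blast
  have "continuous_map Y Y (inv_into (topspace Y) g)"
  proof (rule continuous_map_eq)
    show "continuous_map Y Y k"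
      using k by (simp add: homeomorphic_maps_def)
    show "k y = inv_into (topspace Y) g y" if "y \<in> topspace Y" for y
      using k that bij by (metis bij_betw_def continuous_map_image_subset_topspace
          homeomorphic_maps_def image_subset_iff inv_into_f_eq)
  qed
  then have "continuous_map Y euclideanreal (\<lambda>y. \<tau> (inv_into (topspace Y) g y))"
    using continuous_map_compose[OF _ displ_cont[OF g(2)]] by (simp add: o_def)
  moreover have "inv_into (topspace Y) g y = F (- \<tau> (inv_into (topspace Y) g y)) y"
    if "y \<in> topspace Y" for y
    using displ_eq[OF g(2), of "inv_into (topspace Y) g y"] flow_minus
      bij_betw_inv_into_right[OF bij that] inv_into_into[of y g "topspace Y"] that bij
    by (metis bij_betw_def)
  ultimately show ?thesis
    by (auto simp: displ_def intro: continuous_intros)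
qed

section \<open>The group of displaced bijections\<close>

definition H :: "('b \<Rightarrow> 'b) set" where
  "H = {g \<in> Bij (topspace Y). \<exists>\<tau>. displ g \<tau>}"

abbreviation G :: "('b \<Rightarrow> 'b) monoid" where
  "G \<equiv> BijGroup (topspace Y)\<lparr>carrier := H\<rparr>"

lemma H_D: "g \<in> H \<Longrightarrow> g \<in> Bij (topspace Y)"
  and H_displ: "g \<in> H \<Longrightarrow> \<exists>\<tau>. displ g \<tau>"
  by (auto simp: H_def)

lemma compose_H: "g \<in> H \<Longrightarrow> h \<in> H \<Longrightarrow> compose (topspace Y) g h \<in> H"
  unfolding H_def using compose_Bij displ_compose by blast

lemma inverse_map_H: "g \<in> H \<Longrightarrow> inverse_map g \<in> H"
  unfolding H_def using restrict_inv_into_Bij displ_inverse by blast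

lemma subgroup_H: "subgroup H (BijGroup (topspace Y))"
proof (rule group.subgroupI[OF group_BijGroup])
  show "H \<subseteq> carrier (BijGroup (topspace Y))"
    by (auto simp: BijGroup_def H_def)
  have "displ (\<lambda>y\<in>topspace Y. y) (\<lambda>_. 0)"
    by (simp add: displ_def flow_0)
  then show "H \<noteq> {}"
    unfolding H_def using id_Bij by blast
next
  fix g assume g: "g \<in> H"
  show "inv\<^bsub>BijGroup (topspace Y)\<^esub> g \<in> H"
    using inverse_map_H[OF g] by (simp add: inv_BijGroup H_D[OF g])
next
  fix g h assume g: "g \<in> H" "h \<in> H"
  show "g \<otimes>\<^bsub>BijGroup (topspace Y)\<^esub> h \<in> H"
    using compose_H[OF g] H_D[OF g(1)] H_D[OF g(2)] by (simp add: BijGroup_def)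
qed

lemma group_G: "group G"
  using subgroup.subgroup_is_group[OF subgroup_H group_BijGroup] .

lemma mult_G: "g \<in> H \<Longrightarrow> h \<in> H \<Longrightarrow> g \<otimes>\<^bsub>G\<^esub> h = compose (topspace Y) g h"
  by (simp add: BijGroup_def H_D)

lemma inv_G: "g \<in> H \<Longrightarrow> inv\<^bsub>G\<^esub> g = inverse_map g"
  by (simp add: group.m_inv_consistent[OF group_BijGroup subgroup_H] inv_BijGroup H_D)

section \<open>The distance between displaced maps\<close>

definition dp :: "('b \<Rightarrow> 'b) \<Rightarrow> ('b \<Rightarrow> 'b) \<Rightarrow> real" where
  "dp g h = (INF (\<tau>, \<mu>) \<in> {\<tau>. displ g \<tau>} \<times> {\<mu>. displ h \<mu>}. SUP y \<in> topspace Y. \<bar>\<tau> y - \<mu> y\<bar>)"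

lemma bdd_above_displ_diff:
  assumes "displ g \<tau>" "displ h \<mu>"
  shows "bdd_above ((\<lambda>y. \<bar>\<tau> y - \<mu> y\<bar>) ` topspace Y)"
proof -
  have "continuous_map Y euclideanreal (\<lambda>y. \<tau> y - \<mu> y)"
    using assms by (intro continuous_intros displ_cont)
  then obtain B where "\<And>y. y \<in> topspace Y \<Longrightarrow> \<bar>\<tau> y - \<mu> y\<bar> \<le> B"
    using continuous_map_bounded by blast
  then show ?thesis by (intro bdd_aboveI2[of _ _ B])
qed

lemma sup_displ_nonneg:
  assumes "displ g \<tau>" "displ h \<mu>"
  shows "0 \<le> (SUP y \<in> topspace Y. \<bar>\<tau> y - \<mu> y\<bar>)"
proof -
  obtain y where y: "y \<in> topspace Y" using nonempty_Y by blast
  show ?thesis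
    by (rule cSUP_upper2[OF bdd_above_displ_diff[OF assms] y]) simp
qed

lemma bdd_below_sup_displ:
  "bdd_below ((\<lambda>(\<tau>, \<mu>). SUP y \<in> topspace Y. \<bar>\<tau> y - \<mu> y\<bar>) ` ({\<tau>. displ g \<tau>} \<times> {\<mu>. displ h \<mu>}))"
  using sup_displ_nonneg by (intro bdd_belowI[of _ 0]) auto

lemma dp_nonneg:
  assumes "g \<in> H" "h \<in> H"
  shows "0 \<le> dp g h"
  unfolding dp_def using H_displ[OF assms(1)] H_displ[OF assms(2)]
  by (intro cINF_greatest) (auto intro: sup_displ_nonneg)

lemma dp_le:
  assumes \<tau>: "displ g \<tau>" and \<mu>: "displ h \<mu>" and le: "\<And>y. y \<in> topspace Y \<Longrightarrow> \<bar>\<tau> y - \<mu> y\<bar> \<le> e"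
  shows "dp g h \<le> e"
proof -
  have "(SUP y \<in> topspace Y. \<bar>\<tau> y - \<mu> y\<bar>) \<le> e"
    using nonempty_Y le by (rule cSUP_least)
  then show ?thesis
    unfolding dp_def using \<tau> \<mu> bdd_below_sup_displ
    by (intro cINF_lower2[of _ _ "(\<tau>, \<mu>)"]) auto
qed

text \<open>The differences of displacement functions of \<open>h\<close> take values in periods, so the
  displacement function of \<open>g\<close> may be prescribed.\<close>

lemma dp_lessE:
  assumes h: "h \<in> H" and \<tau>: "displ g \<tau>" and less: "dp g h < e"
  obtains \<mu> where "displ h \<mu>" "\<And>y. y \<in> topspace Y \<Longrightarrow> \<bar>\<tau> y - \<mu> y\<bar> < e"
proof -
  have "{\<tau>. displ g \<tau>} \<times> {\<mu>. displ h \<mu>} \<noteq> {}"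
    using H_displ[OF h] \<tau> by auto
  then obtain \<tau>' \<mu>' where *: "displ g \<tau>'" "displ h \<mu>'" "(SUP y \<in> topspace Y. \<bar>\<tau>' y - \<mu>' y\<bar>) < e"
    using less bdd_below_sup_displ[of g h] unfolding dp_def by (subst (asm) cINF_less_iff) auto
  show thesis
  proof
    \<comment> \<open>Adding \<open>\<tau> - \<tau>'\<close> to both members of the nearly optimal
      pair keeps their difference and makes the first one equal to \<open>\<tau>\<close>.\<close>
    show "displ h (\<lambda>y. \<mu>' y + (\<tau> y - \<tau>' y))"
      using displ_shift *(2) \<tau> *(1) .
    show "\<bar>\<tau> y - (\<mu>' y + (\<tau> y - \<tau>' y))\<bar> < e" if "y \<in> topspace Y" for y
      using cSUP_upper[OF that bdd_above_displ_diff[OF *(1,2)]] *(3) by simp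
  qed
qed

lemma dp_commute_le:
  assumes "g \<in> H" "h \<in> H"
  shows "dp h g \<le> dp g h"
proof (rule dense_ge)
  fix e assume e: "dp g h < e"
  obtain \<tau> where \<tau>: "displ g \<tau>" using H_displ assms by blast
  obtain \<mu> where "displ h \<mu>" "\<And>y. y \<in> topspace Y \<Longrightarrow> \<bar>\<tau> y - \<mu> y\<bar> < e"
    using dp_lessE[OF assms(2) \<tau> e] by blast
  with \<tau> show "dp h g \<le> e"
    by (intro dp_le[of h \<mu> g \<tau>]) (auto simp: abs_minus_commute less_imp_le)
qed

text \<open>Displacement functions are chosen successively for \<open>g\<close>, \<open>h\<close>
  and \<open>k\<close>, each close to the one before, so that the one of \<open>h\<close> is shared
  by both estimates. \<open>dense_ge\<close> passes from numbers above the infima to the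
  infima.\<close>

lemma dp_triangle:
  assumes "g \<in> H" "h \<in> H" "k \<in> H"
  shows "dp g k \<le> dp g h + dp h k"
proof -
  have "dp g k - dp g h \<le> e" if e: "dp h k < e" for e
  proof -
    have "dp g k - e \<le> e'" if e': "dp g h < e'" for e'
    proof -
      obtain \<tau> where \<tau>: "displ g \<tau>" using H_displ assms by blast
      obtain \<mu> where \<mu>: "displ h \<mu>" "\<And>y. y \<in> topspace Y \<Longrightarrow> \<bar>\<tau> y - \<mu> y\<bar> < e'"
        using dp_lessE[OF assms(2) \<tau> e'] by blast
      obtain \<kappa> where \<kappa>: "displ k \<kappa>" "\<And>y. y \<in> topspace Y \<Longrightarrow> \<bar>\<mu> y - \<kappa> y\<bar> < e"
        using dp_lessE[OF assms(3) \<mu>(1) e] by blast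
      have "\<bar>\<tau> y - \<kappa> y\<bar> \<le> e + e'" if "y \<in> topspace Y" for y
        using \<mu>(2)[OF that] \<kappa>(2)[OF that] by linarith
      then have "dp g k \<le> e + e'"
        by (rule dp_le[OF \<tau> \<kappa>(1)])
      then show ?thesis by simp
    qed
    then have "dp g k - e \<le> dp g h" by (rule dense_ge)
    then show ?thesis by simp
  qed
  then have "dp g k - dp g h \<le> dp h k" by (rule dense_ge)
  then show ?thesis by simp
qed

text \<open>The infimum is not known to be attained. But all displacement functions of
  \<open>h\<close> within \<open>1/2\<close> of \<open>\<tau>\<close> agree, so a single
  \<open>\<mu>\<close> satisfies every bound \<open>e\<close>.\<close>

lemma dp_eq_0_imp_eq:
  assumes g: "g \<in> H" and h: "h \<in> H" and 0: "dp g h \<le> 0"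
  shows "g = h"
proof (rule extensionalityI)
  show "g \<in> extensional (topspace Y)" "h \<in> extensional (topspace Y)"
    using assms by (auto intro: Bij_imp_extensional H_D)
  fix y assume y: "y \<in> topspace Y"
  obtain \<tau> where \<tau>: "displ g \<tau>" using H_displ g by blast
  obtain \<mu> where \<mu>: "displ h \<mu>" "\<And>y. y \<in> topspace Y \<Longrightarrow> \<bar>\<tau> y - \<mu> y\<bar> < 1/2"
    using dp_lessE[OF h \<tau>, of "1/2"] 0 by auto
  have "\<bar>\<tau> y - \<mu> y\<bar> < e" if "0 < e" "e < 1/2" for e
  proof -
    obtain \<mu>' where \<mu>': "displ h \<mu>'" "\<And>y. y \<in> topspace Y \<Longrightarrow> \<bar>\<tau> y - \<mu>' y\<bar> < e"
      using dp_lessE[OF h \<tau>, of e] 0 \<open>0 < e\<close> by auto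
    have "\<mu> y = \<mu>' y"
      using \<mu>(2)[OF y] \<mu>'(2)[OF y] \<open>e < 1/2\<close> by (intro displ_unique[OF \<mu>(1) \<mu>'(1) y]) linarith
    with \<mu>'(2)[OF y] show ?thesis by simp
  qed
  note less = this
  have "\<tau> y = \<mu> y"
  proof (rule ccontr)
    assume "\<tau> y \<noteq> \<mu> y"
    then have "\<bar>\<tau> y - \<mu> y\<bar> < \<bar>\<tau> y - \<mu> y\<bar> / 2"
      using \<mu>(2)[OF y] by (intro less) auto
    then show False by simp
  qed
  then show "g y = h y"
    using displ_eq[OF \<tau> y] displ_eq[OF \<mu>(1) y] by simp
qed

text \<open>The composite is displaced by \<open>\<tau> (h y) + \<sigma> y\<close>. Replacing
  \<open>h\<close> by \<open>h'\<close> moves the argument of \<open>\<tau>\<close> along the flow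
  for a short time only, and \<open>\<tau>\<close> changes little under short flow times, uniformly
  in \<open>y\<close> by compactness.\<close>

lemma dp_compose_cont:
  assumes g: "g \<in> H" and h: "h \<in> H" and e: "e > 0"
  obtains \<delta> where "\<delta> > 0"
    "\<And>g' h'. g' \<in> H \<Longrightarrow> h' \<in> H \<Longrightarrow> dp g g' < \<delta> \<Longrightarrow> dp h h' < \<delta> \<Longrightarrow>
       dp (compose (topspace Y) g h) (compose (topspace Y) g' h') < e"
proof -
  obtain \<tau> where \<tau>: "displ g \<tau>" using H_displ g by blast
  obtain \<sigma> where \<sigma>: "displ h \<sigma>" using H_displ h by blast
  have "continuous_map (prod_topology euclideanreal Y) euclideanreal (\<lambda>p. \<tau> (F (fst p) (snd p)))"
    using continuous_map_compose[OF continuous_map_flow[OF continuous_map_fst continuous_map_snd]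
        displ_cont[OF \<tau>]] by (simp add: o_def)
  then obtain U where U: "open U" "0 \<in> U"
      "\<And>t y. t \<in> U \<Longrightarrow> y \<in> topspace Y \<Longrightarrow> norm (\<tau> (F t y) - \<tau> (F 0 y)) < e/4"
    using tube_uniform[OF compact_Y, of euclideanreal "\<lambda>p. \<tau> (F (fst p) (snd p))" 0 "e/4"] e by auto
  then obtain r where r: "r > 0" "ball 0 r \<subseteq> U"
    using openE by blast
  show thesis
  proof
    show "min r (e/4) > 0" using r e by simp
    fix g' h' assume g': "g' \<in> H" "dp g g' < min r (e/4)" and h': "h' \<in> H" "dp h h' < min r (e/4)"
    obtain \<tau>' where \<tau>': "displ g' \<tau>'" "\<And>y. y \<in> topspace Y \<Longrightarrow> \<bar>\<tau> y - \<tau>' y\<bar> < min r (e/4)"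
      using dp_lessE[OF g'(1) \<tau> g'(2)] by blast
    obtain \<sigma>' where \<sigma>': "displ h' \<sigma>'" "\<And>y. y \<in> topspace Y \<Longrightarrow> \<bar>\<sigma> y - \<sigma>' y\<bar> < min r (e/4)"
      using dp_lessE[OF h'(1) \<sigma> h'(2)] by blast
    \<comment> \<open>Three errors below \<open>e/4\<close> add up: from \<open>\<tau>\<close> to
      \<open>\<tau>'\<close> at \<open>h' y\<close>, from \<open>h y\<close> to \<open>h' y\<close>
      inside \<open>\<tau>\<close>, and from \<open>\<sigma>\<close> to
      \<open>\<sigma>'\<close>.\<close>
    have "\<bar>(\<tau> (h y) + \<sigma> y) - (\<tau>' (h' y) + \<sigma>' y)\<bar> \<le> 3/4 * e" if y: "y \<in> topspace Y" for y
    proof -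
      have "h' y = F (\<sigma>' y - \<sigma> y) (h y)"
        using flow_add[OF y, of "\<sigma>' y - \<sigma> y" "\<sigma> y"] displ_eq[OF \<sigma> y] displ_eq[OF \<sigma>'(1) y] by simp
      moreover have "\<sigma>' y - \<sigma> y \<in> U"
        using \<sigma>'(2)[OF y] r(2) by (auto simp: subset_iff dist_real_def)
      ultimately have "\<bar>\<tau> (h' y) - \<tau> (h y)\<bar> < e/4"
        using U(3)[OF _ displ_in[OF \<sigma> y]] flow_0[OF displ_in[OF \<sigma> y]] by simp
      then show ?thesis
        using \<tau>'(2)[OF displ_in[OF \<sigma>'(1) y]] \<sigma>'(2)[OF y] by linarith
    qed
    then have "dp (compose (topspace Y) g h) (compose (topspace Y) g' h') \<le> 3/4 * e"
      by (rule dp_le[OF displ_compose[OF \<tau> \<sigma>] displ_compose[OF \<tau>'(1) \<sigma>'(1)]])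
    then show "dp (compose (topspace Y) g h) (compose (topspace Y) g' h') < e"
      using e by simp
  qed
qed

section \<open>Limits of Cauchy sequences\<close>

definition displ_Cauchy :: "(nat \<Rightarrow> 'b \<Rightarrow> 'b) \<Rightarrow> bool" where
  "displ_Cauchy \<gamma> \<longleftrightarrow> range \<gamma> \<subseteq> H \<and> (\<forall>e>0. \<exists>N. \<forall>m n. N \<le> m \<longrightarrow> N \<le> n \<longrightarrow> dp (\<gamma> m) (\<gamma> n) < e)"

text \<open>Each \<open>T n\<close> is chosen within \<open>1/4\<close> of one fixed displacement
  function, which determines it on \<open>topspace Y\<close>. Smallness of \<open>dp\<close>, an
  infimum over all choices, therefore becomes uniform closeness of these particular
  functions.\<close>

lemma displ_Cauchy_limit:
  assumes "displ_Cauchy \<gamma>"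
  obtains N T \<tau> where "\<And>n. N \<le> n \<Longrightarrow> displ (\<gamma> n) (T n)" "continuous_map Y euclideanreal \<tau>"
    "uniform_limit (topspace Y) T \<tau> sequentially"
proof -
  have H: "\<gamma> n \<in> H" for n
    using assms by (auto simp: displ_Cauchy_def)
  have Cauchy: "\<exists>N. \<forall>m n. N \<le> m \<longrightarrow> N \<le> n \<longrightarrow> dp (\<gamma> m) (\<gamma> n) < e" if "e > 0" for e
    using assms that by (auto simp: displ_Cauchy_def)
  from Cauchy[of "1/4"] obtain N where N: "\<And>n. N \<le> n \<Longrightarrow> dp (\<gamma> N) (\<gamma> n) < 1/4"
    by auto
  obtain \<tau>N where \<tau>N: "displ (\<gamma> N) \<tau>N" using H_displ H by blast
  have "\<exists>\<mu>. displ (\<gamma> n) \<mu> \<and> (\<forall>y \<in> topspace Y. \<bar>\<tau>N y - \<mu> y\<bar> < 1/4)" if "N \<le> n" for n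
    using dp_lessE[OF H \<tau>N N[OF that]] by metis
  then obtain T where T: "\<And>n. N \<le> n \<Longrightarrow> displ (\<gamma> n) (T n)"
      "\<And>n y. N \<le> n \<Longrightarrow> y \<in> topspace Y \<Longrightarrow> \<bar>\<tau>N y - T n y\<bar> < 1/4"
    by metis
  have close: "\<bar>T m y - T n y\<bar> < e"
    if mn: "N \<le> m" "N \<le> n" and d: "dp (\<gamma> m) (\<gamma> n) < e" "e \<le> 1/2" and y: "y \<in> topspace Y" for m n e y
  proof -
    obtain \<mu> where \<mu>: "displ (\<gamma> n) \<mu>" "\<And>y. y \<in> topspace Y \<Longrightarrow> \<bar>T m y - \<mu> y\<bar> < e"
      using dp_lessE[OF H T(1)[OF mn(1)] d(1)] by blast
    \<comment> \<open>\<open>\<mu>\<close> is less than \<open>1/2\<close> away from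
      \<open>T m\<close>, and \<open>T m\<close> less than \<open>1/4 + 1/4\<close> away from
      \<open>T n\<close>; the total is below \<open>1\<close>.\<close>
    have "\<mu> y = T n y"
      using \<mu>(2)[OF y] T(2)[OF mn(1) y] T(2)[OF mn(2) y] d(2)
      by (intro displ_unique[OF \<mu>(1) T(1)[OF mn(2)] y]) linarith
    with \<mu>(2)[OF y] show ?thesis by simp
  qed
  have "uniformly_Cauchy_on (topspace Y) T"
  proof (rule uniformly_Cauchy_onI)
    fix e :: real assume "e > 0"
    then obtain M where M: "\<And>m n. M \<le> m \<Longrightarrow> M \<le> n \<Longrightarrow> dp (\<gamma> m) (\<gamma> n) < min e (1/2)"
      using Cauchy[of "min e (1/2)"] by auto
    have "dist (T m y) (T n y) < e" if "y \<in> topspace Y" "max M N \<le> m" "max M N \<le> n" for y m n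
      using close[of m n "min e (1/2)" y] M[of m n] that by (simp add: dist_real_def)
    then show "\<exists>M. \<forall>x\<in>topspace Y. \<forall>m\<ge>M. \<forall>n\<ge>M. dist (T m x) (T n x) < e"
      by blast
  qed
  then obtain \<tau> where \<tau>: "uniform_limit (topspace Y) T \<tau> sequentially"
    using Cauchy_uniformly_convergent uniformly_convergent_on_def by blast
  have "continuous_map Y (Met_TC.mtopology :: real topology) \<tau>"
  proof (rule Met_TC.continuous_map_uniform_limit[where f = T and F = sequentially])
    show "\<forall>\<^sub>F n in sequentially. continuous_map Y Met_TC.mtopology (T n)"
      using displ_cont[OF T(1)] by (auto simp: eventually_sequentially)
    show "\<forall>\<^sub>F n in sequentially. \<forall>y\<in>topspace Y. \<tau> y \<in> UNIV \<and> dist (T n y) (\<tau> y) < e" if "0 < e" for e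
      using uniform_limitD[OF \<tau> that] by simp
  qed simp
  then show thesis
    using that[of N T \<tau>] T(1) \<tau> by simp
qed

text \<open>The displacement \<open>a n\<close> of \<open>\<gamma> n\<close> after
  \<open>\<eta> n\<close> at \<open>y\<close> is a period of \<open>y\<close>, hence an integer.
  Convergent integers are eventually equal to their limit, so the limit is again a period.\<close>

lemma limit_displ_inverse:
  assumes T: "\<And>n. N \<le> n \<Longrightarrow> displ (\<gamma> n) (T n)" "continuous_map Y euclideanreal \<tau>"
      "uniform_limit (topspace Y) T \<tau> sequentially"
    and S: "\<And>n. N \<le> n \<Longrightarrow> displ (\<eta> n) (S n)" "uniform_limit (topspace Y) S \<sigma> sequentially"
    and inv: "\<And>n. N \<le> n \<Longrightarrow> \<gamma> n (\<eta> n y) = y"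
    and y: "y \<in> topspace Y"
  shows "F (\<tau> (F (\<sigma> y) y)) (F (\<sigma> y) y) = y"
proof -
  define a where "a n = T n (\<eta> n y) + S n y" for n
  have per: "F (a n) y = y" if "N \<le> n" for n
    using displ_eq[OF T(1)[OF that] displ_in[OF S(1)[OF that] y]] inv[OF that]
      displ_eq[OF S(1)[OF that] y] flow_add[OF y] by (simp add: a_def)
  have S_lim: "(\<lambda>n. S n y) \<longlonglongrightarrow> \<sigma> y"
    using tendsto_uniform_limitI[OF S(2) y] .
  have "(\<lambda>n. \<tau> (F (S n y) y)) \<longlonglongrightarrow> \<tau> (F (\<sigma> y) y)"
    using orbit_continuous_on[OF T(2) y] S_lim
    by (intro continuous_on_tendsto_compose[where f = "\<lambda>s. \<tau> (F s y)" and s = UNIV]) auto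
  \<comment> \<open>The arguments \<open>\<eta> n y = F (S n y) y\<close> vary with
    \<open>n\<close>, so the uniformity of the convergence of \<open>T\<close> enters here.\<close>
  moreover have "(\<lambda>n. T n (\<eta> n y) - \<tau> (F (S n y) y)) \<longlonglongrightarrow> 0"
  proof (rule tendstoI)
    fix e :: real assume "e > 0"
    from uniform_limitD[OF T(3) this] eventually_ge_at_top[of N]
    show "\<forall>\<^sub>F n in sequentially. dist (T n (\<eta> n y) - \<tau> (F (S n y) y)) 0 < e"
    proof eventually_elim
      case (elim n)
      with displ_in[OF S(1) y] displ_eq[OF S(1) y] show ?case
        by (auto simp: dist_real_def)
    qed
  qed
  ultimately have "(\<lambda>n. (T n (\<eta> n y) - \<tau> (F (S n y) y)) + \<tau> (F (S n y) y) + S n y)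
      \<longlonglongrightarrow> 0 + \<tau> (F (\<sigma> y) y) + \<sigma> y"
    using S_lim by (intro tendsto_add)
  then have lim: "a \<longlonglongrightarrow> \<tau> (F (\<sigma> y) y) + \<sigma> y"
    by (simp add: a_def[abs_def])
  then obtain M where M: "\<And>n. M \<le> n \<Longrightarrow> \<bar>a n - (\<tau> (F (\<sigma> y) y) + \<sigma> y)\<bar> < 1/2"
    using LIMSEQ_D[of a _ "1/2"] by auto
  have "a n = a (max M N)" if "max M N \<le> n" for n
  proof -
    have "a n - a (max M N) \<in> \<int>"
      using period_Ints[OF y per] that by (intro Ints_diff) auto
    moreover have "\<bar>a n - a (max M N)\<bar> < 1"
      using M[of n] M[of "max M N"] that by linarith
    ultimately have "a n - a (max M N) = 0" using Ints_nonzero_abs_less1 by blast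
    then show ?thesis by simp
  qed
  then have "a \<longlonglongrightarrow> a (max M N)"
    by (intro tendsto_eventually eventually_sequentiallyI)
  then have "a (max M N) = \<tau> (F (\<sigma> y) y) + \<sigma> y"
    using lim LIMSEQ_unique by blast
  then show ?thesis
    using per[of "max M N"] flow_add[OF y] by simp
qed

section \<open>The metric, its completeness and the group topology\<close>

definition Hdist :: "('b \<Rightarrow> 'b) \<Rightarrow> ('b \<Rightarrow> 'b) \<Rightarrow> real" where
  "Hdist g h = (if g \<in> H \<and> h \<in> H then dp g h + dp (inverse_map g) (inverse_map h) else 0)"

lemma inverse_map_inverse_map: "g \<in> H \<Longrightarrow> inverse_map (inverse_map g) = g"
  using group.inv_inv[OF group_G, of g] inv_G inverse_map_H by simp

lemma inverse_map_compose:
  "g \<in> H \<Longrightarrow> h \<in> H \<Longrightarrow>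
    inverse_map (compose (topspace Y) g h) = compose (topspace Y) (inverse_map h) (inverse_map g)"
  using group.inv_mult_group[OF group_G, of g h]
  by (simp add: inv_G mult_G[simplified] compose_H inverse_map_H)

lemma Metric_space_Hdist: "Metric_space H Hdist"
proof
  show "0 \<le> Hdist g h" for g h
    by (simp add: Hdist_def dp_nonneg inverse_map_H)
  show "Hdist g h = Hdist h g" for g h
    using dp_commute_le[of g h] dp_commute_le[of h g] inverse_map_H[of g] inverse_map_H[of h]
      dp_commute_le[of "inverse_map g" "inverse_map h"] dp_commute_le[of "inverse_map h" "inverse_map g"]
    by (auto simp: Hdist_def)
  show "Hdist g h = 0 \<longleftrightarrow> g = h" if g: "g \<in> H" and h: "h \<in> H" for g h
  proof
    assume "Hdist g h = 0"
    then have "dp g h \<le> 0"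
      using g h dp_nonneg[OF inverse_map_H[OF g] inverse_map_H[OF h]] by (simp add: Hdist_def)
    then show "g = h"
      by (rule dp_eq_0_imp_eq[OF g h])
  next
    have "dp k k \<le> 0" if "k \<in> H" for k
      using H_displ[OF that] by (auto intro: dp_le)
    then have "dp k k = 0" if "k \<in> H" for k
      using dp_nonneg[OF that that] that by (simp add: order_antisym)
    moreover assume "g = h"
    ultimately show "Hdist g h = 0"
      using g inverse_map_H by (simp add: Hdist_def)
  qed
  show "Hdist g k \<le> Hdist g h + Hdist h k" if "g \<in> H" "h \<in> H" "k \<in> H" for g h k
    using dp_triangle[OF that] dp_triangle[OF that[THEN inverse_map_H]] that by (simp add: Hdist_def)
qed

text \<open>Convergence of the displacement functions of \<open>\<gamma>\<close> alone gives just a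
  continuous limit map \<open>g\<close>. The second summand of the distance makes the inverses
  converge too, and their limit \<open>h\<close> is the inverse of \<open>g\<close>.\<close>

lemma mcomplete_Hdist: "Metric_space.mcomplete H Hdist"
proof -
  interpret M: Metric_space H Hdist by (rule Metric_space_Hdist)
  show ?thesis
    unfolding M.mcomplete_def
  proof (intro allI impI)
    fix \<gamma> assume \<gamma>: "M.MCauchy \<gamma>"
    then have \<gamma>H: "\<gamma> n \<in> H" for n
      by (auto simp: M.MCauchy_def)
    define \<eta> where "\<eta> n = inverse_map (\<gamma> n)" for n
    have \<eta>H: "\<eta> n \<in> H" for n
      by (simp add: \<eta>_def inverse_map_H \<gamma>H)
    have dist: "Hdist (\<gamma> m) (\<gamma> n) = dp (\<gamma> m) (\<gamma> n) + dp (\<eta> m) (\<eta> n)" for m n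
      by (simp add: Hdist_def \<gamma>H \<eta>_def)
    have le: "dp (\<gamma> m) (\<gamma> n) \<le> Hdist (\<gamma> m) (\<gamma> n)" "dp (\<eta> m) (\<eta> n) \<le> Hdist (\<gamma> m) (\<gamma> n)" for m n
      using dp_nonneg \<gamma>H \<eta>H by (auto simp: dist)
    have small: "\<exists>N. \<forall>m n. N \<le> m \<longrightarrow> N \<le> n \<longrightarrow> Hdist (\<gamma> m) (\<gamma> n) < e" if "e > 0" for e
      using \<gamma> that by (simp add: M.MCauchy_def)
    have C: "displ_Cauchy \<gamma>" "displ_Cauchy \<eta>"
      using small \<gamma>H \<eta>H unfolding displ_Cauchy_def
      by (meson le le_less_trans image_subsetI)+
    obtain N1 T \<tau> where T: "\<And>n. N1 \<le> n \<Longrightarrow> displ (\<gamma> n) (T n)" "continuous_map Y euclideanreal \<tau>"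
        "uniform_limit (topspace Y) T \<tau> sequentially"
      using displ_Cauchy_limit[OF C(1)] by blast
    obtain N2 S \<sigma> where S: "\<And>n. N2 \<le> n \<Longrightarrow> displ (\<eta> n) (S n)" "continuous_map Y euclideanreal \<sigma>"
        "uniform_limit (topspace Y) S \<sigma> sequentially"
      using displ_Cauchy_limit[OF C(2)] by blast
    define N where "N = max N1 N2"
    have inv1: "\<gamma> n (\<eta> n y) = y" if "y \<in> topspace Y" for n y
      using that H_D[OF \<gamma>H, of n] bij_betw_inv_into_right[of "\<gamma> n" "topspace Y" "topspace Y"] by (simp add: \<eta>_def Bij_def)
    have inv2: "\<eta> n (\<gamma> n y) = y" if "y \<in> topspace Y" for n y
      using that H_D[OF \<gamma>H, of n] bij_betw_inv_into_left[of "\<gamma> n" "topspace Y" "topspace Y"]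
        bij_betwE[of "\<gamma> n" "topspace Y" "topspace Y"]
      by (simp add: \<eta>_def Bij_def)
    define g where "g = (\<lambda>y\<in>topspace Y. F (\<tau> y) y)"
    define h where "h = (\<lambda>y\<in>topspace Y. F (\<sigma> y) y)"
    have g: "displ g \<tau>" and h: "displ h \<sigma>"
      using T S by (auto simp: displ_def g_def h_def)
    have gh: "g (h y) = y" if y: "y \<in> topspace Y" for y
      using limit_displ_inverse[of N \<gamma> T \<tau> \<eta> S \<sigma> y] T S inv1[OF y] y
      by (simp add: N_def g_def h_def flow_in)
    have hg: "h (g y) = y" if y: "y \<in> topspace Y" for y
      using limit_displ_inverse[of N \<eta> S \<sigma> \<gamma> T \<tau> y] T S inv2[OF y] y
      by (simp add: N_def g_def h_def flow_in)
    have bij: "bij_betw g (topspace Y) (topspace Y)"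
      by (rule bij_betw_byWitness[of _ h]) (use gh hg displ_in[OF g] displ_in[OF h] in auto)
    then have gH: "g \<in> H"
      using g by (auto simp: H_def Bij_def g_def)
    have "inverse_map g = h"
    proof (rule extensionalityI)
      show "inverse_map g y = h y" if "y \<in> topspace Y" for y
        using that bij gh[OF that] displ_in[OF h that] by (simp add: inv_into_f_eq bij_betw_def)
    qed (auto simp: h_def)
    then have "Hdist (\<gamma> n) g = dp (\<gamma> n) g + dp (\<eta> n) h" for n
      by (simp add: Hdist_def \<gamma>H gH \<eta>_def)
    note dist_lim = this
    show "\<exists>g. limitin M.mtopology \<gamma> g sequentially"
      unfolding M.limitin_metric
    proof (intro exI[of _ g] conjI gH allI impI)
      fix e :: real assume "e > 0"
      then have "e / 4 > 0" by simp
      from uniform_limitD[OF T(3) this] uniform_limitD[OF S(3) this] eventually_ge_at_top[of N]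
      show "\<forall>\<^sub>F n in sequentially. \<gamma> n \<in> H \<and> Hdist (\<gamma> n) g < e"
      proof eventually_elim
        case (elim n)
        have "dp (\<gamma> n) g \<le> e / 4"
          using elim T(1) by (intro dp_le[OF _ g, where \<tau> = "T n"]) (auto simp: N_def dist_real_def less_imp_le)
        moreover have "dp (\<eta> n) h \<le> e / 4"
          using elim S(1) by (intro dp_le[OF _ h, where \<tau> = "S n"]) (auto simp: N_def dist_real_def less_imp_le)
        ultimately show ?case
          using \<open>e > 0\<close> \<gamma>H dist_lim by simp
      qed
    qed
  qed
qed

lemma group_topology_Hdist: "group_topology G (Metric_space.mtopology H Hdist)"
proof -
  interpret M: Metric_space H Hdist by (rule Metric_space_Hdist)
  have inv: "continuous_map M.mtopology M.mtopology (\<lambda>g. inv\<^bsub>G\<^esub> g)"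
    unfolding M.continuous_map_to_metric
  proof (intro ballI allI impI)
    fix g and e :: real assume "g \<in> topspace M.mtopology" "e > 0"
    then have g: "g \<in> H" by simp
    \<comment> \<open>Inversion exchanges the two summands of the distance and so is an
      isometry.\<close>
    have "Hdist (inverse_map g) (inverse_map h) = Hdist g h" if "h \<in> H" for h
      using g that by (simp add: Hdist_def inverse_map_H inverse_map_inverse_map)
    then show "\<exists>U. openin M.mtopology U \<and> g \<in> U \<and> (\<forall>h\<in>U. inv\<^bsub>G\<^esub> h \<in> M.mball (inv\<^bsub>G\<^esub> g) e)"
      using g \<open>e > 0\<close> by (intro exI[of _ "M.mball g e"]) (auto simp: inv_G inverse_map_H)
  qed
  have mult: "continuous_map (prod_topology M.mtopology M.mtopology) M.mtopology (\<lambda>(g, h). g \<otimes>\<^bsub>G\<^esub> h)"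
    unfolding M.continuous_map_to_metric
  proof (intro ballI allI impI)
    fix p and e :: real assume "p \<in> topspace (prod_topology M.mtopology M.mtopology)" and e: "e > 0"
    then obtain g h where p: "p = (g, h)" and g: "g \<in> H" and h: "h \<in> H" by auto
    let ?c = "compose (topspace Y)"
    obtain \<delta>1 where \<delta>1: "\<delta>1 > 0" "\<And>g' h'. g' \<in> H \<Longrightarrow> h' \<in> H \<Longrightarrow> dp g g' < \<delta>1 \<Longrightarrow> dp h h' < \<delta>1 \<Longrightarrow>
        dp (?c g h) (?c g' h') < e / 2"
      by (rule dp_compose_cont[OF g h half_gt_zero[OF e]]) (rule that)
    \<comment> \<open>Inverting a product reverses its factors, so for the second summand the
      inverse of \<open>h\<close> stands first.\<close>
    obtain \<delta>2 where \<delta>2: "\<delta>2 > 0" "\<And>h' g'. h' \<in> H \<Longrightarrow> g' \<in> H \<Longrightarrow>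
        dp (inverse_map h) h' < \<delta>2 \<Longrightarrow> dp (inverse_map g) g' < \<delta>2 \<Longrightarrow>
        dp (?c (inverse_map h) (inverse_map g)) (?c h' g') < e / 2"
      by (rule dp_compose_cont[OF inverse_map_H[OF h] inverse_map_H[OF g] half_gt_zero[OF e]]) (rule that)
    define \<delta> where "\<delta> = min \<delta>1 \<delta>2"
    have \<delta>: "\<delta> > 0" using \<delta>1 \<delta>2 by (simp add: \<delta>_def)
    have "Hdist (?c g h) (?c g' h') < e"
      if g': "g' \<in> H" "Hdist g g' < \<delta>" and h': "h' \<in> H" "Hdist h h' < \<delta>" for g' h'
    proof -
      have small: "dp k k' < \<delta>" "dp (inverse_map k) (inverse_map k') < \<delta>"
        if "k \<in> H" "k' \<in> H" "Hdist k k' < \<delta>" for k k'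
        using that dp_nonneg[of k k'] dp_nonneg[of "inverse_map k" "inverse_map k'"]
        by (auto simp: Hdist_def inverse_map_H)
      have "dp (?c g h) (?c g' h') < e / 2"
        using \<delta>1(2)[OF g'(1) h'(1)] small[OF g g'] small[OF h h'] by (simp add: \<delta>_def)
      moreover have "dp (?c (inverse_map h) (inverse_map g)) (?c (inverse_map h') (inverse_map g')) < e / 2"
        using \<delta>2(2)[OF inverse_map_H[OF h'(1)] inverse_map_H[OF g'(1)]] small[OF g g'] small[OF h h']
        by (simp add: \<delta>_def)
      ultimately show ?thesis
        using g h g' h' by (simp add: Hdist_def compose_H inverse_map_compose)
    qed
    then show "\<exists>U. openin (prod_topology M.mtopology M.mtopology) U \<and> p \<in> U \<and>
        (\<forall>q\<in>U. (case q of (g, h) \<Rightarrow> g \<otimes>\<^bsub>G\<^esub> h) \<in> M.mball (case p of (g, h) \<Rightarrow> g \<otimes>\<^bsub>G\<^esub> h) e)"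
      using g h \<delta> by (intro exI[of _ "M.mball g \<delta> \<times> M.mball h \<delta>"])
        (auto simp: p openin_prod_Times_iff mult_G[simplified] compose_H)
  qed
  show ?thesis
    unfolding group_topology_def using group_G inv mult by simp
qed

end

section \<open>The suspension flow\<close>

context stone_system
begin

abbreviation cover :: "('a \<times> real) topology" where
  "cover \<equiv> prod_topology X euclideanreal"

abbreviation q :: "'a \<times> real \<Rightarrow> ('a \<times> real) set" where
  "q \<equiv> sus_class X \<phi>"

abbreviation Y :: "('a \<times> real) set topology" where
  "Y \<equiv> suspension X \<phi>"

lemma quotient_map_q: "quotient_map cover Y q"
  unfolding suspension_def by (rule quotient_map_quotient_topology)

lemma continuous_map_q: "continuous_map cover Y q"
  using quotient_map_q by (rule quotient_imp_continuous_map)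

lemma topspace_Y: "topspace Y = q ` (topspace X \<times> UNIV)"
  by (simp add: suspension_def)

lemma q_zpow: "x \<in> topspace X \<Longrightarrow> q (zpow X \<phi> n x, t - of_int n) = q (x, t)"
  using sus_class_eq_iff[of x "zpow X \<phi> n x" t "t - of_int n"] zpow_in[of x n]
  by (auto simp: zact_def)

lemma continuous_map_zpow: "continuous_map X X (zpow X \<phi> n)"
proof -
  have phi: "continuous_map X X \<phi>"
    using homeo homeomorphic_imp_continuous_map by blast
  obtain k where k: "homeomorphic_maps X X \<phi> k"
    using homeo homeomorphic_map_maps by blast
  have "continuous_map X X (inv_into (topspace X) \<phi>)"
  proof (rule continuous_map_eq)
    show "continuous_map X X k"
      using k by (simp add: homeomorphic_maps_def)
    then show "k x = inv_into (topspace X) \<phi> x" if "x \<in> topspace X" for x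
      using k that bij_phi continuous_map_image_subset_topspace[of X X k]
      by (metis bij_betw_def homeomorphic_maps_def image_subset_iff inv_into_f_eq)
  qed
  moreover have "continuous_map X X (f ^^ m)" if "continuous_map X X f" for f m
    by (induction m) (use that continuous_map_compose in \<open>auto simp: o_def\<close>)
  ultimately have "continuous_map X X (\<phi> ^^ nat n)" "continuous_map X X (inv_into (topspace X) \<phi> ^^ nat (- n))"
    using phi by blast+
  then show ?thesis
    by (cases "0 \<le> n") (simp_all add: zpow_def[abs_def])
qed

lemma continuous_map_zact: "continuous_map cover cover (zact X \<phi> n)"
proof -
  have "continuous_map cover X (\<lambda>p. zpow X \<phi> n (fst p))"
    using continuous_map_compose[OF continuous_map_fst continuous_map_zpow] by (simp add: o_def)
  then show ?thesis
    unfolding zact_def case_prod_unfold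
    by (intro continuous_map_pairedI continuous_intros continuous_map_snd)
qed

text \<open>The saturation of \<open>U\<close> is the union of its preimages under the continuous
  maps \<open>zact X \<phi> n\<close>.\<close>

lemma open_map_q: "open_map cover Y q"
  unfolding open_map_def
proof (intro allI impI)
  fix U assume U: "openin cover U"
  then have sub: "U \<subseteq> topspace X \<times> UNIV"
    using openin_subset by fastforce
  have "{p \<in> topspace cover. q p \<in> q ` U} = (\<Union>n. {p \<in> topspace cover. zact X \<phi> n p \<in> U})"
  proof (intro subset_antisym subsetI)
    fix p assume p: "p \<in> {p \<in> topspace cover. q p \<in> q ` U}"
    then obtain x t y s where "p = (x, t)" "x \<in> topspace X" "(y, s) \<in> U" "q (x, t) = q (y, s)"
      by (cases p) auto
    moreover from this have "y \<in> topspace X"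
      using sub by auto
    ultimately show "p \<in> (\<Union>n. {p \<in> topspace cover. zact X \<phi> n p \<in> U})"
      using sus_class_eq_iff[of x y t s] by auto
  next
    fix p assume "p \<in> (\<Union>n. {p \<in> topspace cover. zact X \<phi> n p \<in> U})"
    then obtain x t n where p: "p = (x, t)" "x \<in> topspace X" "zact X \<phi> n (x, t) \<in> U"
      by (cases p) auto
    then have "q (zact X \<phi> n (x, t)) = q (x, t)"
      using q_zpow by (simp add: zact_def)
    then show "p \<in> {p \<in> topspace cover. q p \<in> q ` U}"
      using p by (auto simp: image_iff intro!: bexI[of _ "zact X \<phi> n (x, t)"])
  qed
  moreover have "openin cover {p \<in> topspace cover. zact X \<phi> n p \<in> U}" for n
    using openin_continuous_map_preimage[OF continuous_map_zact U] .
  ultimately have "openin cover {p \<in> topspace cover. q p \<in> q ` U}"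
    by auto
  moreover have "q ` U \<subseteq> topspace Y"
    using sub by (auto simp: topspace_Y)
  ultimately show "openin Y (q ` U)"
    using quotient_map_q by (simp add: quotient_map_def)
qed

section \<open>The circle coordinate and flow boxes\<close>

definition circ :: "('a \<times> real) set \<Rightarrow> complex" where
  "circ w = cis (2 * pi * snd (SOME p. p \<in> w))"

text \<open>Representatives of one class differ by integers in the real coordinate, so the choice
  made by \<open>SOME\<close> does not matter.\<close>

lemma circ_q: "circ (q (x, t)) = cis (2 * pi * t)"
proof -
  have "(SOME p. p \<in> q (x, t)) \<in> q (x, t)"
    by (rule someI_ex) (auto simp: sus_class_def)
  then obtain n :: int where n: "snd (SOME p. p \<in> q (x, t)) = t - of_int n"
    by (auto simp: sus_class_def zact_def)
  have "cis (2 * pi * (t - of_int n)) = cis (2 * pi * t) / cis (2 * pi * of_int n)"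
    by (simp add: cis_divide algebra_simps)
  also have "cis (2 * pi * of_int n) = 1"
    by (rule cis_multiple_2pi) simp
  finally show ?thesis
    by (simp add: circ_def n)
qed

lemma norm_circ: "norm (circ w) = 1"
  by (simp add: circ_def)

lemma continuous_map_circ: "continuous_map Y euclidean circ"
proof (rule continuous_compose_quotient_map[OF quotient_map_q])
  have "continuous_map euclideanreal euclidean (\<lambda>t. cis (2 * pi * t))"
    by (simp add: continuous_intros)
  from continuous_map_compose[OF continuous_map_snd this]
  show "continuous_map cover euclidean (circ \<circ> q)"
    by (rule continuous_map_eq) (auto simp: circ_q)
qed

text \<open>Every class has a representative at distance at most \<open>1/2\<close> from
  \<open>t0\<close> in the real coordinate, and distance exactly \<open>1/2\<close> occurs only over
  the antipode excluded by \<open>ne\<close>. In the open range the principal argument recovers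
  \<open>t\<close> from the circle coordinate.\<close>

lemma box_rep:
  assumes w: "w \<in> topspace Y" and ne: "circ w \<noteq> - cis (2 * pi * t0)"
  obtains x t where "x \<in> topspace X" "w = q (x, t)" "\<bar>t - t0\<bar> < 1/2"
    "t = t0 + Arg (circ w / cis (2 * pi * t0)) / (2 * pi)"
proof -
  obtain x' t' where x': "x' \<in> topspace X" "w = q (x', t')"
    using w by (auto simp: topspace_Y)
  define n where "n = round (t' - t0)"
  define t where "t = t' - of_int n"
  have wt: "w = q (zpow X \<phi> n x', t)"
    using q_zpow[OF x'(1)] x'(2) by (simp add: t_def)
  have circ_w: "circ w = cis (2 * pi * t)"
    by (simp add: wt circ_q)
  have "\<bar>t - t0\<bar> \<le> 1/2"
    using of_int_round_abs_le[of "t' - t0"] by (simp add: t_def n_def abs_minus_commute algebra_simps)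
  moreover have "- cis (2 * pi * t0) = cis (2 * pi * (t0 + 1/2))"
    by (simp add: minus_cis distrib_left)
  moreover have "- cis (2 * pi * t0) = cis (2 * pi * (t0 - 1/2))"
    by (simp add: minus_cis' right_diff_distrib)
  ultimately have "\<bar>t - t0\<bar> \<le> 1/2" "t \<noteq> t0 + 1/2" "t \<noteq> t0 - 1/2"
    using ne circ_w by metis+
  then have less: "\<bar>t - t0\<bar> < 1/2"
    by linarith
  have "circ w / cis (2 * pi * t0) = cis (2 * pi * (t - t0))"
    by (simp add: circ_w cis_divide algebra_simps)
  moreover have "Arg (cis (2 * pi * (t - t0))) = 2 * pi * (t - t0)"
  proof (rule Arg_cis)
    have "2 * (t - t0) < 1"
      using abs_less_iff[THEN iffD1, OF less] by (auto simp: field_simps)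
    moreover have "-1 < 2 * (t - t0)"
      using abs_less_iff[THEN iffD1, OF less] by (auto simp: field_simps)
    ultimately have "pi * (2 * (t - t0)) < pi * 1" "pi * (-1) < pi * (2 * (t - t0))"
      by (simp_all only: mult_less_cancel_left_pos[OF pi_gt_zero])
    then show "2 * pi * (t - t0) \<in> {- pi<..pi}"
      by (simp add: algebra_simps)
  qed
  ultimately have "t = t0 + Arg (circ w / cis (2 * pi * t0)) / (2 * pi)"
    by simp
  then show thesis
    using that wt less zpow_in[OF x'(1)] by blast
qed

text \<open>The integer relating the two representatives is the difference of their real
  coordinates. Hence \<open>q\<close> is injective over every open interval of length
  \<open>1\<close>.\<close>

lemma q_eq_close:
  assumes "x \<in> topspace X" "y \<in> topspace X" "q (x, s) = q (y, t)" "\<bar>s - t\<bar> < 1"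
  shows "x = y \<and> s = t"
proof -
  obtain n where n: "y = zpow X \<phi> n x" "t = s - of_int n"
    using assms sus_class_eq_iff[of x y s t] by (auto simp: zact_def)
  then have "n = 0" using assms(4) by auto
  with n show ?thesis by (simp add: zpow_0)
qed

text \<open>Points with different circle coordinates are separated on the circle. Otherwise they
  have representatives with a common real coordinate and distinct coordinates in \<open>X\<close>;
  disjoint neighbourhoods in \<open>X\<close> times a short interval have disjoint images.\<close>

lemma Hausdorff_Y: "Hausdorff_space Y"
  unfolding Hausdorff_space_def
proof (intro allI impI)
  fix z w assume zw: "z \<in> topspace Y \<and> w \<in> topspace Y \<and> z \<noteq> w"
  show "\<exists>U V. openin Y U \<and> openin Y V \<and> z \<in> U \<and> w \<in> V \<and> disjnt U V"
  proof (cases "circ z = circ w")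
    case False
    then obtain U V where UV: "open U" "open V" "circ z \<in> U" "circ w \<in> V" "U \<inter> V = {}"
      using hausdorff[OF False] by blast
    then have "openin Y {y \<in> topspace Y. circ y \<in> U}" "openin Y {y \<in> topspace Y. circ y \<in> V}"
      by (auto intro: openin_continuous_map_preimage[OF continuous_map_circ])
    with UV zw show ?thesis
      by (intro exI[of _ "{y \<in> topspace Y. circ y \<in> U}"] exI[of _ "{y \<in> topspace Y. circ y \<in> V}"])
        (auto simp: disjnt_iff)
  next
    case True
    obtain x t where x: "x \<in> topspace X" "z = q (x, t)"
      using zw by (auto simp: topspace_Y)
    have circ: "circ w = cis (2 * pi * t)"
      using True x by (simp add: circ_q)
    \<comment> \<open>The quotient of circle coordinates in \<open>box_rep\<close> is
      \<open>1\<close>, with argument \<open>0\<close>, so the real coordinate is exactly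
      \<open>t\<close>.\<close>
    obtain y where y: "y \<in> topspace X" "w = q (y, t)"
      using box_rep[of w t] zw circ by force
    with x zw have "x \<noteq> y" by blast
    then obtain U V where UV: "openin X U" "openin X V" "x \<in> U" "y \<in> V" "disjnt U V"
      using Hausdorff x y unfolding Hausdorff_space_def by blast
    let ?I = "{t - 1/4<..<t + 1/4}"
    have "openin cover (U \<times> ?I)" "openin cover (V \<times> ?I)"
      using UV by (auto simp: openin_prod_Times_iff)
    then have "openin Y (q ` (U \<times> ?I))" "openin Y (q ` (V \<times> ?I))"
      using open_map_q by (auto simp: open_map_def)
    moreover have "z \<in> q ` (U \<times> ?I)" "w \<in> q ` (V \<times> ?I)"
      using x y UV by auto
    moreover have "disjnt (q ` (U \<times> ?I)) (q ` (V \<times> ?I))"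
      unfolding disjnt_iff
    proof (intro allI notI)
      fix c assume "c \<in> q ` (U \<times> ?I) \<and> c \<in> q ` (V \<times> ?I)"
      then obtain u s v r where c: "u \<in> U" "s \<in> ?I" "v \<in> V" "r \<in> ?I" "q (u, s) = q (v, r)"
        by auto
      have "u \<in> topspace X" "v \<in> topspace X" "\<bar>s - r\<bar> < 1"
        using c UV openin_subset by fastforce+
      then have "u = v"
        using q_eq_close c(5) by blast
      with c UV show False by (auto simp: disjnt_iff)
    qed
    ultimately show ?thesis by blast
  qed
qed

text \<open>Acting by the floor of the real coordinate brings every class into the image of the
  compact set \<open>topspace X \<times> {0..1}\<close>.\<close>

lemma compact_Y: "compact_space Y"
proof -
  have "topspace Y \<subseteq> q ` (topspace X \<times> {0..1})"
  proof
    fix w assume "w \<in> topspace Y"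
    then obtain x t where x: "x \<in> topspace X" "w = q (x, t)"
      by (auto simp: topspace_Y)
    have "w = q (zpow X \<phi> \<lfloor>t\<rfloor> x, t - of_int \<lfloor>t\<rfloor>)"
      using q_zpow x by simp
    moreover have "t - of_int \<lfloor>t\<rfloor> \<in> {0..1}"
      using floor_correct[of t] by (auto simp: algebra_simps)
    ultimately show "w \<in> q ` (topspace X \<times> {0..1})"
      using zpow_in[OF x(1)] by blast
  qed
  moreover have "q ` (topspace X \<times> {0..1}) \<subseteq> topspace Y"
    by (auto simp: topspace_Y)
  moreover have "compactin cover (topspace X \<times> {0..1})"
    using compact by (simp add: compactin_Times compact_space_def)
  ultimately show ?thesis
    using image_compactin[OF _ continuous_map_q] unfolding compact_space_def
    by (metis subset_antisym)
qed

lemma sus_flow_continuous: "continuous_map (prod_topology euclideanreal Y) Y (\<lambda>(t, y). sus_flow t y)"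
proof -
  \<comment> \<open>The product of \<open>q\<close> with the identity remains a quotient map because
    the real line is locally compact; continuity of the flow then descends from translation on the
    cover.\<close>
  have quo: "quotient_map (prod_topology cover euclideanreal) (prod_topology Y euclideanreal) (\<lambda>(p, t). (q p, t))"
    by (rule quotient_map_prod_left[OF _ _ quotient_map_q]) (simp_all add: locally_compact_space_euclidean)
  have "continuous_map (prod_topology cover euclideanreal) X (\<lambda>p. fst (fst p))"
    using continuous_map_compose[OF continuous_map_fst continuous_map_fst] by (simp add: o_def)
  moreover have "continuous_map (prod_topology cover euclideanreal) euclideanreal (\<lambda>p. snd (fst p))"
    using continuous_map_compose[OF continuous_map_fst continuous_map_snd] by (simp add: o_def)
  ultimately have "continuous_map (prod_topology cover euclideanreal) cover
      (\<lambda>p. (fst (fst p), snd (fst p) + snd p))"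
    by (intro continuous_map_pairedI continuous_intros continuous_map_snd)
  from continuous_map_compose[OF this continuous_map_q]
  have "continuous_map (prod_topology cover euclideanreal) Y
      ((\<lambda>(y, t). sus_flow t y) \<circ> (\<lambda>(p, t). (q p, t)))"
    by (rule continuous_map_eq) (auto simp: sus_flow_class)
  from continuous_compose_quotient_map[OF quo this]
  have "continuous_map (prod_topology Y euclideanreal) Y (\<lambda>(y, t). sus_flow t y)" .
  from continuous_map_compose[OF continuous_map_pairedI[OF continuous_map_snd continuous_map_fst] this]
  show ?thesis
    by (simp add: o_def case_prod_unfold)
qed

lemma sus_flow_add: "sus_flow (s + t) y = sus_flow s (sus_flow t y)"
  by (force simp: sus_flow_def image_image case_prod_unfold algebra_simps)

sublocale S: integral_flow Y sus_flow
proof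
  show "compact_space Y" "Hausdorff_space Y"
    by (fact compact_Y Hausdorff_Y)+
  show "topspace Y \<noteq> {}"
    using nonempty by (simp add: topspace_Y)
  show "continuous_map (prod_topology euclideanreal Y) Y (\<lambda>(t, y). sus_flow t y)"
    by (fact sus_flow_continuous)
  show "sus_flow 0 y = y" for y
    by (simp add: sus_flow_def)
  show "sus_flow (s + t) y = sus_flow s (sus_flow t y)" for s t y
    by (fact sus_flow_add)
  fix y c assume "y \<in> topspace Y" and c: "sus_flow c y = y"
  then obtain x t where x: "x \<in> topspace X" "y = q (x, t)"
    by (auto simp: topspace_Y)
  then have "q (x, t + c) = q (x, t)"
    using c by (simp add: sus_flow_class)
  then obtain n where "t = t + c - of_int n"
    using sus_class_eq_iff[OF x(1) x(1)] by (auto simp: zact_def)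
  then show "c \<in> \<int>" by auto
qed

text \<open>Over the circle minus a point the suspension is a product of \<open>X\<close> with an interval, and
  connected subsets of \<open>X\<close> are singletons.\<close>

lemma connected_in_box:
  assumes C: "connectedin Y C" and z: "z \<in> C" and w: "w \<in> C"
    and box: "\<And>w. w \<in> C \<Longrightarrow> circ w \<noteq> - circ z"
  shows "w = sus_flow (Arg (circ w / circ z) / (2 * pi)) z"
proof -
  have CY: "C \<subseteq> topspace Y"
    using C by (rule connectedin_subset_topspace)
  obtain x0 t0 where x0: "x0 \<in> topspace X" "z = q (x0, t0)"
    using z CY by (auto simp: topspace_Y)
  have circ_z: "circ z = cis (2 * pi * t0)"
    by (simp add: x0 circ_q)
  \<comment> \<open>A flow box of length \<open>1\<close> around the fibre of \<open>z\<close>: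
    \<open>q\<close> is open and injective on it, hence an embedding.\<close>
  define I where "I = topspace X \<times> {t0 - 1/2<..<t0 + 1/2}"
  have I: "openin cover I"
    by (simp add: I_def openin_prod_Times_iff)
  have topI: "topspace (subtopology cover I) = I"
    by (auto simp: I_def)
  have "inj_on q I"
  proof (rule inj_onI)
    fix p p' assume "p \<in> I" "p' \<in> I" "q p = q p'"
    then show "p = p'"
      using q_eq_close[of "fst p" "fst p'" "snd p" "snd p'"] by (auto simp: I_def)
  qed
  then have "embedding_map (subtopology cover I) Y q"
    using open_map_from_subtopology[OF open_map_q I] continuous_map_from_subtopology[OF continuous_map_q]
    by (intro injective_open_imp_embedding_map) (simp_all only: topI)
  then obtain k where k: "homeomorphic_maps (subtopology cover I) (subtopology Y (q ` I)) q k"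
    unfolding embedding_map_def topI homeomorphic_map_maps by blast
  have CI: "C \<subseteq> q ` I"
  proof
    fix w assume "w \<in> C"
    then obtain x t where "x \<in> topspace X" "w = q (x, t)" "\<bar>t - t0\<bar> < 1/2"
      using box_rep[of w t0] box CY circ_z by (metis subsetD)
    moreover from this have "t0 - 1/2 < t \<and> t < t0 + 1/2"
      by linarith
    ultimately have "(x, t) \<in> I" "w = q (x, t)"
      by (auto simp: I_def)
    then show "w \<in> q ` I"
      by blast
  qed
  then have "connectedin (subtopology Y (q ` I)) C"
    using C by (simp add: connectedin_subtopology)
  then have "connectedin (subtopology cover I) (k ` C)"
    using k connectedin_continuous_map_image by (auto simp: homeomorphic_maps_def)
  then have "connectedin cover (k ` C)"
    by (simp add: connectedin_subtopology)
  then have conn: "connectedin X (fst ` k ` C)"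
    using connectedin_continuous_map_image continuous_map_fst by blast
  have kq: "k (q p) = p" if "p \<in> I" for p
    using k that topI by (simp add: homeomorphic_maps_def)
  have "x0 \<in> fst ` k ` C"
    using kq[of "(x0, t0)"] x0 z by (force simp: I_def)
  \<comment> \<open>The coordinates in \<open>X\<close> of the points of \<open>C\<close> form a
    connected set containing \<open>x0\<close>, so total disconnectedness leaves only
    \<open>x0\<close> and \<open>C\<close> lies on one flow line.\<close>
  then have "fst ` k ` C \<subseteq> {x0}"
    using connected_component_of_maximal[OF conn] totally_disconnected x0
    by (auto simp: totally_disconnected_space_def)
  moreover obtain x t where xt: "x \<in> topspace X" "w = q (x, t)" "\<bar>t - t0\<bar> < 1/2"
      "t = t0 + Arg (circ w / cis (2 * pi * t0)) / (2 * pi)"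
    using box_rep[of w t0] box[OF w] CY w circ_z by (metis subsetD)
  moreover from xt(3) have "t0 - 1/2 < t \<and> t < t0 + 1/2"
    by linarith
  then have "k w = (x, t)"
    using kq[of "(x, t)"] xt(1,2) by (auto simp: I_def)
  ultimately have "x = x0"
    using w by force
  then have "w = q (x0, t0 + Arg (circ w / circ z) / (2 * pi))"
    using xt circ_z by metis
  then show ?thesis
    using x0 by (metis sus_flow_class)
qed

section \<open>Isotopies to the identity\<close>

text \<open>A non-positive real of absolute value \<open>1\<close> is \<open>-1\<close>. The
  conclusion keeps the quotient off the branch cut of \<open>Arg\<close>.\<close>

lemma unit_quotient_not_nonpos:
  fixes u v :: complex
  assumes "norm u = 1" "norm v = 1" "u \<noteq> - v"
  shows "u / v \<notin> \<real>\<^sub>\<le>\<^sub>0"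
proof
  assume "u / v \<in> \<real>\<^sub>\<le>\<^sub>0"
  then obtain r where r: "u / v = of_real r" "r \<le> 0"
    by (auto elim: nonpos_Reals_cases)
  moreover have "norm (u / v) = 1"
    using assms by (simp add: norm_divide)
  ultimately have "u / v = -1" by auto
  moreover have "v \<noteq> 0" using assms(2) by auto
  ultimately show False using assms(3) by (simp add: divide_eq_eq)
qed

text \<open>Two times are related when the stages of the isotopy at these times differ by a
  continuous displacement. This is an equivalence relation with open classes, so connectedness of
  \<open>{0..1}\<close> relates time \<open>1\<close>, the identity, to time \<open>0\<close>, which
  is \<open>g\<close>.\<close>

lemma isotopic_id_imp_displ:
  assumes "homotopic_with (homeomorphic_map Y Y) Y Y g (\<lambda>y. y)"
  shows "\<exists>\<tau>. S.displ g \<tau>"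
proof -
  let ?T = "top_of_set {0..1::real}"
  obtain h where h: "continuous_map (prod_topology ?T Y) Y h"
    and h0: "\<And>y. h (0, y) = g y" and h1: "\<And>y. h (1, y) = y"
    using assms unfolding homotopic_with_def by blast
  have h_in: "h (t, y) \<in> topspace Y" if "t \<in> {0..1}" "y \<in> topspace Y" for t y
    using continuous_map_funspace[OF h] that by (auto simp: Pi_iff)
  have circ_h: "continuous_map (prod_topology ?T Y) euclidean (circ \<circ> h)"
    using continuous_map_compose[OF h continuous_map_circ] .
  define R where "R t t' \<longleftrightarrow> (\<exists>\<sigma>. continuous_map Y euclideanreal \<sigma> \<and>
      (\<forall>y \<in> topspace Y. h (t', y) = sus_flow (\<sigma> y) (h (t, y))))" for t t'
  have "R 1 0"
  proof (rule connected_equivalence_relation[of "{0..1::real}"])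
    show "R t' t" if R: "R t t'" and "t \<in> {0..1}" "t' \<in> {0..1}" for t t'
    proof -
      obtain \<sigma> where \<sigma>: "continuous_map Y euclideanreal \<sigma>"
          "\<And>y. y \<in> topspace Y \<Longrightarrow> h (t', y) = sus_flow (\<sigma> y) (h (t, y))"
        using R(1) by (auto simp: R_def)
      have "continuous_map Y euclideanreal (\<lambda>y. - \<sigma> y)"
        using \<sigma>(1) by (rule continuous_map_minus)
      then show ?thesis
        unfolding R_def using \<sigma>(2) S.flow_minus h_in[OF that(2)]
        by (intro exI[of _ "\<lambda>y. - \<sigma> y"]) simp
    qed
  next
    show "R t t''" if R: "R t t'" "R t' t''" and "t \<in> {0..1}" "t' \<in> {0..1}" "t'' \<in> {0..1}" for t t' t''
    proof -
      obtain \<sigma> where \<sigma>: "continuous_map Y euclideanreal \<sigma>"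
          "\<And>y. y \<in> topspace Y \<Longrightarrow> h (t', y) = sus_flow (\<sigma> y) (h (t, y))"
        using R(1) by (auto simp: R_def)
      obtain \<rho> where \<rho>: "continuous_map Y euclideanreal \<rho>"
          "\<And>y. y \<in> topspace Y \<Longrightarrow> h (t'', y) = sus_flow (\<rho> y) (h (t', y))"
        using R(2) by (auto simp: R_def)
      have "continuous_map Y euclideanreal (\<lambda>y. \<rho> y + \<sigma> y)"
        using \<rho>(1) \<sigma>(1) by (rule continuous_map_add)
      then show ?thesis
        unfolding R_def using \<sigma>(2) \<rho>(2)
        by (intro exI[of _ "\<lambda>y. \<rho> y + \<sigma> y"]) (simp add: sus_flow_add)
    qed
  next
    fix t :: real assume t: "t \<in> {0..1}"
    \<comment> \<open>Antipodes on the circle are at distance \<open>2\<close>, so the bound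
      \<open>1\<close> keeps every \<open>h (s, y)\<close> with \<open>s\<close> near
      \<open>t\<close> in the flow box around \<open>h (t, y)\<close>, uniformly in
      \<open>y\<close>.\<close>
    obtain U where U: "openin ?T U" "t \<in> U"
        "\<And>t' y. t' \<in> U \<Longrightarrow> y \<in> topspace Y \<Longrightarrow> norm ((circ \<circ> h) (t', y) - (circ \<circ> h) (t, y)) < 1"
      using tube_uniform[OF compact_Y circ_h, of t 1] t by auto
    then obtain r where r: "r > 0" "ball t r \<inter> {0..1} \<subseteq> U"
      unfolding openin_contains_ball by blast
    let ?V = "ball t r \<inter> {0..1}"
    have opp: "circ (h (s, y)) \<noteq> - circ (h (t, y))" if "s \<in> ?V" "y \<in> topspace Y" for s y
    proof
      assume "circ (h (s, y)) = - circ (h (t, y))"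
      then have "norm ((circ \<circ> h) (s, y) - (circ \<circ> h) (t, y)) = norm (- (2 * circ (h (t, y))))"
        by (intro arg_cong[where f = norm]) simp
      also have "\<dots> = 2"
        by (simp add: norm_mult norm_circ)
      finally show False
        using U(3)[of s y] that r(2) by auto
    qed
    have "R t t'" if t': "t' \<in> ?V" for t'
    proof -
      let ?u = "\<lambda>y. (circ (h (t', y)), circ (h (t, y)))"
      \<comment> \<open>On \<open>D\<close> the principal argument of the quotient is continuous,
        which makes the displacement continuous in \<open>y\<close>.\<close>
      define D where "D = {(a, b) :: complex \<times> complex | a b. b \<noteq> 0 \<and> a / b \<notin> \<real>\<^sub>\<le>\<^sub>0}"
      have c: "continuous_map Y euclidean (\<lambda>y. circ (h (s, y)))" if "s \<in> {0..1}" for s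
        using continuous_map_o_Pair[OF circ_h, of s] that by (simp add: o_def)
      have "continuous_map Y euclidean ?u"
        using continuous_map_pairedI[OF c[of t'] c[of t]] t t' by simp
      moreover have "?u y \<in> D" if "y \<in> topspace Y" for y
        using unit_quotient_not_nonpos[OF norm_circ norm_circ opp[OF t' that]] norm_circ[of "h (t, y)"]
        by (auto simp: D_def)
      ultimately have "continuous_map Y (top_of_set D) ?u"
        by (simp add: continuous_map_in_subtopology image_subset_iff)
      moreover have "continuous_map (top_of_set D) euclideanreal (\<lambda>p. Arg (fst p / snd p) / (2 * pi))"
        unfolding continuous_map_iff_continuous
        by (intro continuous_intros) (auto simp: D_def)
      ultimately have "continuous_map Y euclideanreal
          ((\<lambda>p. Arg (fst p / snd p) / (2 * pi)) \<circ> ?u)"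
        by (rule continuous_map_compose)
      \<comment> \<open>The path \<open>s \<mapsto> h (s, y)\<close> over \<open>?V\<close> is
        connected and avoids the antipodal fibre, so it stays on one flow line.\<close>
      moreover have "h (t', y) = sus_flow (Arg (circ (h (t', y)) / circ (h (t, y))) / (2 * pi)) (h (t, y))"
        if y: "y \<in> topspace Y" for y
      proof (rule connected_in_box)
        have "continuous_map ?T Y (\<lambda>s. h (s, y))"
          using continuous_map_compose[OF continuous_map_pairedI[of ?T ?T id Y "\<lambda>_. y"] h] y
          by (simp add: o_def)
        moreover have "connectedin ?T ?V"
          by (simp add: connectedin_subtopology convex_connected convex_Int)
        ultimately show "connectedin Y ((\<lambda>s. h (s, y)) ` ?V)"
          by (rule connectedin_continuous_map_image)
        show "h (t, y) \<in> (\<lambda>s. h (s, y)) ` ?V" "h (t', y) \<in> (\<lambda>s. h (s, y)) ` ?V"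
          using t t' r(1) by auto
        show "circ w \<noteq> - circ (h (t, y))" if "w \<in> (\<lambda>s. h (s, y)) ` ?V" for w
          using that opp[OF _ y] by blast
      qed
      ultimately show ?thesis
        unfolding R_def by (auto simp: o_def)
    qed
    moreover have "openin ?T ?V"
      by (metis Int_commute open_ball openin_open_Int)
    moreover have "t \<in> ?V"
      using t r by simp
    ultimately show "\<exists>V. openin ?T V \<and> t \<in> V \<and> (\<forall>t'\<in>V. R t t')"
      by blast
  qed auto
  then show ?thesis
    unfolding R_def S.displ_def by (simp add: h0 h1)
qed

section \<open>Identification of \<open>H0\<close> with the displaced bijections\<close>

lemma H0_eq: "H0 X \<phi> = S.G"
proof -
  \<comment> \<open>One inclusion rests on total disconnectedness, the other on scaling the
    displacement.\<close>
  have "{g \<in> Bij (topspace Y). homotopic_with (homeomorphic_map Y Y) Y Y g (\<lambda>y. y)} = S.H"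
    unfolding S.H_def using isotopic_id_imp_displ S.displ_imp_isotopic_id
    by (auto simp: Bij_def bij_betw_def)
  then show ?thesis
    by (simp add: H0_def Let_def)
qed

lemma H0_dist_eq: "H0_dist X \<phi> = S.Hdist"
proof -
  have "displacement_fun X \<phi> = S.displ"
    by (intro ext) (simp add: displacement_fun_def S.displ_def)
  then have "dplus X \<phi> = S.dp"
    by (intro ext) (simp add: dplus_def S.dp_def)
  then show ?thesis
    by (intro ext) (simp add: H0_dist_def S.Hdist_def H0_eq S.inv_G)
qed

end

theorem propositionA1:
  fixes X :: "'a topology" and \<phi> :: "'a \<Rightarrow> 'a"
  assumes "stone_system X \<phi>"
  shows "Metric_space (carrier (H0 X \<phi>)) (H0_dist X \<phi>) \<and>
         Metric_space.mcomplete (carrier (H0 X \<phi>)) (H0_dist X \<phi>) \<and>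
         group_topology (H0 X \<phi>) (Metric_space.mtopology (carrier (H0 X \<phi>)) (H0_dist X \<phi>))"
proof -
  interpret stone_system X \<phi> by fact
  show ?thesis
    using S.Metric_space_Hdist S.mcomplete_Hdist S.group_topology_Hdist
    by (simp add: H0_eq H0_dist_eq)
qed

end
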